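(* There do not exist a constant $C\ge 1$, integers $m(n)\in\mathbb{N}$ and maps $f_n: V(L_n)\to V(D_{m(n)})$ ($n\in\mathbb{N}$) such that each $f_n$ is a $C$-bilipschitz embedding, i.e. for each $n$ there is $r_n>0$ with $r_n\, d_{L_n}(u,v)\le d_{D_{m(n)}}(f_n u,f_n v)\le C r_n\, d_{L_n}(u,v)$ for all $u,v\in V(L_n)$. In other words, the sequence of Laakso graphs does not admit uniformly bilipschitz embeddings into the sequence of diamond graphs.
   Context: All graphs carry the shortest-path metric on their vertex sets; edges have length $1$ (the statement is the same for the weighted normalizations below, since rescaling does not affect distortion). Diamond graphs: $D_0$ consists of two vertices joined by an edge; $D_n$ is obtained from $D_{n-1}$ by replacing every edge $uv$ by a quadrilateral $u,a,v,b$ with edges $ua,av,vb,bu$ ($a,b$ new vertices). Laakso graphs: $L_0$ consists of two vertices joined by an edge; $L_1$ is the graph with vertices $x_1,\dots,x_6$ and edges $x_1x_2, x_2x_3, x_2x_4, x_3x_5, x_4x_5, x_5x_6$ (a path of length 1, then a 4-cycle $x_2x_3x_5x_4$, then a path of length 1); $L_n$ is obtained from $L_{n-1}$ by replacing every edge $uv$ by a copy of $L_1$, with $u$ and $v$ identified with the two degree-one vertices $x_1,x_6$ of $L_1$. *)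

theory Defs
  imports Complex_Main
begin

text \<open>Vertices of the recursively built graphs. A vertex created when the
  (oriented) edge (u,v) is replaced by a gadget is named Mid (u,v) i, where i is
  the label of the internal vertex of the gadget.\<close>
datatype vtx = Base nat | Mid "vtx \<times> vtx" nat

text \<open>A graph is given by its set of (oriented) edges; the vertex set consists
  of all endpoints (none of these graphs has isolated vertices).\<close>
definition verts :: "(vtx \<times> vtx) set \<Rightarrow> vtx set" where
  "verts E = fst ` E \<union> snd ` E"

definition adj :: "(vtx \<times> vtx) set \<Rightarrow> vtx \<Rightarrow> vtx \<Rightarrow> bool" where
  "adj E x y \<longleftrightarrow> (x, y) \<in> E \<or> (y, x) \<in> E"

definition walk :: "(vtx \<times> vtx) set \<Rightarrow> vtx list \<Rightarrow> bool" where
  "walk E xs \<longleftrightarrow> xs \<noteq> [] \<and> (\<forall>i. Suc i < length xs \<longrightarrow> adj E (xs ! i) (xs ! Suc i))"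

definition gdist :: "(vtx \<times> vtx) set \<Rightarrow> vtx \<Rightarrow> vtx \<Rightarrow> nat" where
  "gdist E u v = (LEAST k. \<exists>xs. walk E xs \<and> hd xs = u \<and> last xs = v \<and> length xs = Suc k)"

definition diamond_step :: "(vtx \<times> vtx) set \<Rightarrow> (vtx \<times> vtx) set" where
  "diamond_step E = (\<Union>(u, v)\<in>E.
     {(u, Mid (u, v) 0), (Mid (u, v) 0, v), (u, Mid (u, v) 1), (Mid (u, v) 1, v)})"

fun diamond :: "nat \<Rightarrow> (vtx \<times> vtx) set" where
  "diamond 0 = {(Base 0, Base 1)}"
| "diamond (Suc n) = diamond_step (diamond n)"

text \<open>Laakso step: each edge uv becomes a copy of L_1 with x1 = u, x6 = v and
  internal vertices x2,...,x5 named Mid (u,v) 2, ..., Mid (u,v) 5.\<close>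
definition laakso_step :: "(vtx \<times> vtx) set \<Rightarrow> (vtx \<times> vtx) set" where
  "laakso_step E = (\<Union>(u, v)\<in>E.
     {(u, Mid (u, v) 2), (Mid (u, v) 2, Mid (u, v) 3), (Mid (u, v) 2, Mid (u, v) 4),
      (Mid (u, v) 3, Mid (u, v) 5), (Mid (u, v) 4, Mid (u, v) 5), (Mid (u, v) 5, v)})"

fun laakso :: "nat \<Rightarrow> (vtx \<times> vtx) set" where
  "laakso 0 = {(Base 0, Base 1)}"
| "laakso (Suc n) = laakso_step (laakso n)"

end

theory Submission
  imports Defs
begin

text \<open>Two scales are compared. If \<open>L_n\<close> embeds with distortion \<open>C\<close>, let \<open>M_k\<close> be \<open>4^k\<close> times the
  largest image length of a level-\<open>k\<close> edge. By the triangle inequality \<open>M_k\<close> is nondecreasing in \<open>k\<close>,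
  and it grows by a factor of at most \<open>C\<close>; so for large \<open>n\<close> it is almost constant on a long block
  of levels, and some edge is embedded in such a way that all geodesics between its ends (at the
  resolution of the end of the block) have nearly geodesic images, up to one step of length \<open>w\<close>.

  Each vertex of \<open>D_m\<close> lies in a cell of diameter \<open>2^i\<close> that can only be left through two poles
  from \<open>D_(m-i)\<close>. At a pole of a 4-cycle in \<open>L_n\<close> three geodesics start: a stem and the two sides of
  the cycle. If they are long enough to leave the cell, two of them leave it close to the same
  pole, hence the image of the branch point is within \<open>O(w)\<close> of \<open>D_(m-i)\<close>. Apply this to two branch
  points at distance \<open>\<lambda>\<close>, the upper pole of a cycle of length \<open>4\<lambda>\<close> and the lower pole of a cycle of
  length \<open>16\<lambda>\<close>: for the \<open>i\<close> with \<open>\<lambda>w < 2^i \<le> 2\<lambda>w\<close> both images are close to \<open>D_(m-i)\<close>, whose points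
  are \<open>2^i\<close>-separated, so \<open>2^i\<close> is close to \<open>\<lambda>w\<close>. But then the argument also applies to \<open>i + 1\<close>, and
  the images, at distance at most \<open>\<lambda>w\<close>, would be close to distinct points at distance \<open>2^(i+1) > 2\<lambda>w\<close>.\<close>

section \<open>Graph distance and connectedness\<close>

definition sym_edges :: "(vtx \<times> vtx) set \<Rightarrow> (vtx \<times> vtx) set" where
  "sym_edges E = E \<union> E\<inverse>"

text \<open>If no walk joins two vertices, the \<open>LEAST\<close> in \<open>gdist\<close> is an
  unspecified number. Connectedness makes it attained by a walk, which gives the triangle
  inequality.\<close>

definition connected_edges :: "(vtx \<times> vtx) set \<Rightarrow> bool" where
  "connected_edges E \<longleftrightarrow> (\<forall>x\<in>verts E. \<forall>y\<in>verts E. (x, y) \<in> (sym_edges E)\<^sup>*)"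

lemma adj_iff: "adj E x y \<longleftrightarrow> (x, y) \<in> sym_edges E"
  by (auto simp: adj_def sym_edges_def)

text \<open>Walks become powers of one relation, so that concatenation and reversal are the algebra
  of relation powers.\<close>

lemma walk_iff_relpow:
  "(\<exists>xs. walk E xs \<and> hd xs = u \<and> last xs = v \<and> length xs = Suc k) \<longleftrightarrow> (u, v) \<in> sym_edges E ^^ k"
proof
  assume "\<exists>xs. walk E xs \<and> hd xs = u \<and> last xs = v \<and> length xs = Suc k"
  then obtain xs where xs: "walk E xs" "hd xs = u" "last xs = v" "length xs = Suc k" by blast
  then have "xs ! 0 = u" "xs ! k = v"
    by (metis hd_conv_nth list.size(3) nat.distinct(1),
        metis diff_Suc_1 last_conv_nth list.size(3) nat.distinct(1))
  with xs show "(u, v) \<in> sym_edges E ^^ k"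
    unfolding relpow_fun_conv walk_def adj_iff by (intro exI[of _ "(!) xs"]) auto
next
  assume "(u, v) \<in> sym_edges E ^^ k"
  then obtain f where f: "f 0 = u" "f k = v" "\<forall>i<k. (f i, f (Suc i)) \<in> sym_edges E"
    unfolding relpow_fun_conv by blast
  have "walk E (map f [0..<Suc k])"
    unfolding walk_def adj_iff using f(3) by (auto simp del: upt_Suc)
  moreover have "hd (map f [0..<Suc k]) = u" "last (map f [0..<Suc k]) = v"
    using f by (auto simp: hd_map simp del: upt_Suc, auto)
  ultimately show "\<exists>xs. walk E xs \<and> hd xs = u \<and> last xs = v \<and> length xs = Suc k"
    by (intro exI[of _ "map f [0..<Suc k]"]) auto
qed

lemma gdist_eq_Least: "gdist E u v = (LEAST k. (u, v) \<in> sym_edges E ^^ k)"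
  unfolding gdist_def walk_iff_relpow ..

lemma gdist_le: "(u, v) \<in> sym_edges E ^^ k \<Longrightarrow> gdist E u v \<le> k"
  unfolding gdist_eq_Least by (rule Least_le)

lemma gdist_relpow:
  assumes "connected_edges E" "u \<in> verts E" "v \<in> verts E"
  shows "(u, v) \<in> sym_edges E ^^ gdist E u v"
proof -
  obtain k where "(u, v) \<in> sym_edges E ^^ k"
    using assms unfolding connected_edges_def by (meson rtrancl_imp_relpow)
  then show ?thesis
    unfolding gdist_eq_Least by (rule LeastI)
qed

lemma relpow_sym_edges_commute: "(u, v) \<in> sym_edges E ^^ k \<Longrightarrow> (v, u) \<in> sym_edges E ^^ k"
proof (induction k arbitrary: v)
  case (Suc k)
  then obtain z where "(z, u) \<in> sym_edges E ^^ k" "(v, z) \<in> sym_edges E"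
    by (auto simp: sym_edges_def)
  then show ?case by (rule relpow_Suc_I2[rotated])
qed auto

lemma gdist_commute: "gdist E u v = gdist E v u"
  unfolding gdist_eq_Least by (metis relpow_sym_edges_commute)

lemma gdist_triangle:
  assumes "connected_edges E" "x \<in> verts E" "y \<in> verts E" "z \<in> verts E"
  shows "gdist E x z \<le> gdist E x y + gdist E y z"
  by (rule gdist_le) (use assms gdist_relpow in \<open>auto simp: relpow_add\<close>)

lemma gdist_self [simp]: "gdist E x x = 0"
  using gdist_le[of x x 0 E] by simp

lemma gdist_edge: "(x, y) \<in> E \<Longrightarrow> gdist E x y \<le> 1"
  using gdist_le[of x y 1 E] by (auto simp: sym_edges_def)

lemma lipschitz_relpow:
  fixes \<phi> :: "vtx \<Rightarrow> real"
  assumes "\<And>a b. (a, b) \<in> E \<Longrightarrow> \<bar>\<phi> a - \<phi> b\<bar> \<le> c"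
  shows "(x, y) \<in> sym_edges E ^^ k \<Longrightarrow> \<bar>\<phi> x - \<phi> y\<bar> \<le> c * real k"
proof (induction k arbitrary: y)
  case (Suc k)
  then obtain z where z: "(x, z) \<in> sym_edges E ^^ k" "(z, y) \<in> sym_edges E" by auto
  have "\<bar>\<phi> z - \<phi> y\<bar> \<le> c"
    using z(2) assms[of z y] assms[of y z] by (auto simp: sym_edges_def abs_minus_commute)
  with Suc.IH[OF z(1)] show ?case by (simp add: algebra_simps)
qed auto

text \<open>Lower bounds on distances are obtained from this: it suffices to exhibit a function that
  varies little along edges and much between the two vertices.\<close>

lemma lipschitz_gdist:
  fixes \<phi> :: "vtx \<Rightarrow> real"
  assumes "connected_edges E" "x \<in> verts E" "y \<in> verts E"
    and "\<And>a b. (a, b) \<in> E \<Longrightarrow> \<bar>\<phi> a - \<phi> b\<bar> \<le> c"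
  shows "\<bar>\<phi> x - \<phi> y\<bar> \<le> c * real (gdist E x y)"
  by (rule lipschitz_relpow[OF assms(4) gdist_relpow[OF assms(1-3)]])

lemma lipschitz_chain:
  fixes \<phi> :: "vtx \<Rightarrow> real"
  assumes "\<And>a b. (a, b) \<in> E \<Longrightarrow> \<bar>\<phi> a - \<phi> b\<bar> \<le> c"
    and "\<And>t. t < T \<Longrightarrow> (Z t, Z (Suc t)) \<in> E" and "i \<le> j" "j \<le> T"
  shows "\<bar>\<phi> (Z i) - \<phi> (Z j)\<bar> \<le> c * (real j - real i)"
  using assms(3,4)
proof (induction rule: dec_induct)
  case (step t)
  with assms(1)[OF assms(2)[of t]] show ?case by (simp add: algebra_simps)
qed auto

lemma edge_verts: "(x, y) \<in> E \<Longrightarrow> x \<in> verts E \<and> y \<in> verts E"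
  by (force simp: verts_def)

lemma sym_edges_mono: "E \<subseteq> F \<Longrightarrow> sym_edges E \<subseteq> sym_edges F"
  by (auto simp: sym_edges_def)

lemma verts_mono: "E \<subseteq> F \<Longrightarrow> verts E \<subseteq> verts F"
  by (auto simp: verts_def)

lemma sym_edges_intro: "(x, y) \<in> E \<Longrightarrow> (x, y) \<in> sym_edges E" "(x, y) \<in> E \<Longrightarrow> (y, x) \<in> sym_edges E"
  by (auto simp: sym_edges_def)

lemma sym_edges_rtrancl_commute: "(x, y) \<in> (sym_edges E)\<^sup>* \<Longrightarrow> (y, x) \<in> (sym_edges E)\<^sup>*"
  by (meson relpow_sym_edges_commute rtrancl_imp_relpow relpow_imp_rtrancl)

lemma connected_edges_refine:
  assumes "connected_edges E"
    and "\<And>u v. (u, v) \<in> E \<Longrightarrow> (u, v) \<in> (sym_edges F)\<^sup>*"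
    and "\<And>x. x \<in> verts F \<Longrightarrow> \<exists>y\<in>verts E. (x, y) \<in> (sym_edges F)\<^sup>*"
  shows "connected_edges F"
  unfolding connected_edges_def
proof (intro ballI)
  fix x y assume "x \<in> verts F" "y \<in> verts F"
  then obtain x' y' where *: "x' \<in> verts E" "(x, x') \<in> (sym_edges F)\<^sup>*" "y' \<in> verts E" "(y, y') \<in> (sym_edges F)\<^sup>*"
    using assms(3) by metis
  have "sym_edges E \<subseteq> (sym_edges F)\<^sup>*"
    using assms(2) sym_edges_rtrancl_commute unfolding sym_edges_def by fast
  then have "(sym_edges E)\<^sup>* \<subseteq> (sym_edges F)\<^sup>*"
    by (metis rtrancl_mono rtrancl_idemp)
  then have "(x', y') \<in> (sym_edges F)\<^sup>*"
    using assms(1) * unfolding connected_edges_def by blast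
  with * show "(x, y) \<in> (sym_edges F)\<^sup>*"
    by (meson rtrancl_trans sym_edges_rtrancl_commute)
qed

section \<open>Creation depth of vertices and the two refinement steps\<close>

fun depth :: "vtx \<Rightarrow> nat" where
  "depth (Base n) = 0"
| "depth (Mid (u, v) i) = Suc (max (depth u) (depth v))"

text \<open>Since every edge has an end of depth exactly \<open>k\<close> and none deeper, the
  vertices created in the next step all have depth \<open>Suc k\<close>. Depth thus tells new
  vertices from old ones.\<close>

definition at_level :: "nat \<Rightarrow> (vtx \<times> vtx) set \<Rightarrow> bool" where
  "at_level k E \<longleftrightarrow> (\<forall>(u, v)\<in>E. max (depth u) (depth v) = k)"

lemma at_level_verts: "at_level k E \<Longrightarrow> x \<in> verts E \<Longrightarrow> depth x \<le> k"
  by (auto simp: at_level_def verts_def)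

lemma diamond_step_cases:
  assumes "(x, y) \<in> diamond_step E"
  obtains u v i where "(u, v) \<in> E" "i = 0 \<or> i = 1" "x = u \<and> y = Mid (u, v) i \<or> x = Mid (u, v) i \<and> y = v"
  using assms by (auto simp: diamond_step_def)

lemma laakso_step_cases:
  assumes "(x, y) \<in> laakso_step E"
  obtains u v where "(u, v) \<in> E" "x = u \<and> y = Mid (u, v) 2"
  | u v i where "(u, v) \<in> E" "i = 3 \<or> i = 4" "x = Mid (u, v) 2 \<and> y = Mid (u, v) i"
  | u v i where "(u, v) \<in> E" "i = 3 \<or> i = 4" "x = Mid (u, v) i \<and> y = Mid (u, v) 5"
  | u v where "(u, v) \<in> E" "x = Mid (u, v) 5 \<and> y = v"
  using assms by (auto simp: laakso_step_def)

lemma diamond_stepI: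
  assumes "(u, v) \<in> E" "i = 0 \<or> i = 1"
  shows "(u, Mid (u, v) i) \<in> diamond_step E" "(Mid (u, v) i, v) \<in> diamond_step E"
  using assms by (auto simp: diamond_step_def)

lemma laakso_stepI:
  assumes "(u, v) \<in> E"
  shows "(u, Mid (u, v) 2) \<in> laakso_step E" "(Mid (u, v) 5, v) \<in> laakso_step E"
    and "i = 3 \<or> i = 4 \<Longrightarrow> (Mid (u, v) 2, Mid (u, v) i) \<in> laakso_step E"
    and "i = 3 \<or> i = 4 \<Longrightarrow> (Mid (u, v) i, Mid (u, v) 5) \<in> laakso_step E"
  using assms by (auto simp: laakso_step_def)

lemma at_level_diamond_step: "at_level k E \<Longrightarrow> at_level (Suc k) (diamond_step E)"
  by (auto simp: at_level_def diamond_step_def)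

lemma at_level_laakso_step: "at_level k E \<Longrightarrow> at_level (Suc k) (laakso_step E)"
  by (auto simp: at_level_def laakso_step_def)

lemma at_level_diamond: "at_level k (diamond k)"
  by (induction k) (auto simp: at_level_diamond_step, simp add: at_level_def)

lemma at_level_laakso: "at_level k (laakso k)"
  by (induction k) (auto simp: at_level_laakso_step, simp add: at_level_def)

lemma verts_diamond_step: "verts E \<subseteq> verts (diamond_step E)"
proof -
  have "u \<in> verts (diamond_step E) \<and> v \<in> verts (diamond_step E)" if "(u, v) \<in> E" for u v
    using diamond_stepI[OF that, of 0] edge_verts by blast
  then show ?thesis unfolding verts_def[of E] by auto
qed

lemma verts_laakso_step: "verts E \<subseteq> verts (laakso_step E)"
proof -
  have "u \<in> verts (laakso_step E) \<and> v \<in> verts (laakso_step E)" if "(u, v) \<in> E" for u v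
    using laakso_stepI(1,2)[OF that] edge_verts by blast
  then show ?thesis unfolding verts_def[of E] by auto
qed

lemma verts_diamond_mono: "i \<le> j \<Longrightarrow> verts (diamond i) \<subseteq> verts (diamond j)"
  by (induction rule: dec_induct) (use verts_diamond_step in \<open>simp_all, blast\<close>)

lemma verts_laakso_mono: "i \<le> j \<Longrightarrow> verts (laakso i) \<subseteq> verts (laakso j)"
  by (induction rule: dec_induct) (use verts_laakso_step in \<open>simp_all, blast\<close>)

lemma verts_diamond_step_cases:
  assumes "x \<in> verts (diamond_step E)"
  shows "x \<in> verts E \<or> (\<exists>u v i. (u, v) \<in> E \<and> (i = 0 \<or> i = 1) \<and> x = Mid (u, v) i)"
proof -
  obtain y where "(x, y) \<in> diamond_step E \<or> (y, x) \<in> diamond_step E"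
    using assms by (simp add: verts_def) fastforce
  then show ?thesis
    by (metis diamond_step_cases edge_verts)
qed

lemma connected_diamond: "connected_edges (diamond n)"
proof (induction n)
  case 0
  show ?case by (auto simp: connected_edges_def verts_def sym_edges_def)
next
  case (Suc n)
  have 1: "(u, Mid (u, v) i) \<in> sym_edges (diamond_step (diamond n))"
    "(Mid (u, v) i, u) \<in> sym_edges (diamond_step (diamond n))"
    "(Mid (u, v) i, v) \<in> sym_edges (diamond_step (diamond n))"
    if "(u, v) \<in> diamond n" "i = 0 \<or> i = 1" for u v i
    using diamond_stepI[OF that] by (auto intro: sym_edges_intro)
  show ?case
  proof (rule connected_edges_refine[OF Suc])
    show "(u, v) \<in> (sym_edges (diamond (Suc n)))\<^sup>*" if "(u, v) \<in> diamond n" for u v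
      using 1[OF that, of 0] by simp
    show "\<exists>y\<in>verts (diamond n). (x, y) \<in> (sym_edges (diamond (Suc n)))\<^sup>*"
      if "x \<in> verts (diamond (Suc n))" for x
    proof -
      have "x \<in> verts (diamond n) \<or> (\<exists>u v i. (u, v) \<in> diamond n \<and> (i = 0 \<or> i = 1) \<and> x = Mid (u, v) i)"
        using verts_diamond_step_cases that by simp
      then show ?thesis
        using 1 edge_verts by (metis diamond.simps(2) r_into_rtrancl rtrancl.rtrancl_refl)
    qed
  qed
qed

lemma connected_laakso: "connected_edges (laakso n)"
proof (induction n)
  case 0
  show ?case by (auto simp: connected_edges_def verts_def sym_edges_def)
next
  case (Suc n)
  let ?R = "sym_edges (laakso_step (laakso n))"
  have 1: "(u, Mid (u, v) 2) \<in> ?R\<^sup>*" "(u, Mid (u, v) 3) \<in> ?R\<^sup>*" "(u, Mid (u, v) 4) \<in> ?R\<^sup>*"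
    "(u, Mid (u, v) 5) \<in> ?R\<^sup>*" "(u, v) \<in> ?R\<^sup>*"
    if "(u, v) \<in> laakso n" for u v
  proof -
    note I = laakso_stepI[OF that, THEN sym_edges_intro(1)]
    show 2: "(u, Mid (u, v) 2) \<in> ?R\<^sup>*" using I(1) by blast
    show 3: "(u, Mid (u, v) 3) \<in> ?R\<^sup>*" using 2 I(3)[of 3] by (meson rtrancl.rtrancl_into_rtrancl)
    show "(u, Mid (u, v) 4) \<in> ?R\<^sup>*" using 2 I(3)[of 4] by (meson rtrancl.rtrancl_into_rtrancl)
    show 5: "(u, Mid (u, v) 5) \<in> ?R\<^sup>*" using 3 I(4)[of 3] by (meson rtrancl.rtrancl_into_rtrancl)
    show "(u, v) \<in> ?R\<^sup>*" using 5 I(2) by (meson rtrancl.rtrancl_into_rtrancl)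
  qed
  show ?case
  proof (rule connected_edges_refine[OF Suc])
    show "(u, v) \<in> (sym_edges (laakso (Suc n)))\<^sup>*" if "(u, v) \<in> laakso n" for u v
      using 1[OF that] by simp
    show "\<exists>y\<in>verts (laakso n). (x, y) \<in> (sym_edges (laakso (Suc n)))\<^sup>*"
      if x: "x \<in> verts (laakso (Suc n))" for x
    proof -
      obtain y where "(x, y) \<in> laakso_step (laakso n) \<or> (y, x) \<in> laakso_step (laakso n)"
        using x by (simp add: verts_def) fastforce
      then have "x \<in> verts (laakso n) \<or>
          (\<exists>u v i. (u, v) \<in> laakso n \<and> i \<in> {2, 3, 4, 5} \<and> x = Mid (u, v) i)"
        by (auto elim!: laakso_step_cases dest: edge_verts)
      then show ?thesis
        using 1 edge_verts sym_edges_rtrancl_commute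
        by simp (metis rtrancl.rtrancl_refl)
    qed
  qed
qed

section \<open>Extension of Lipschitz functions over one refinement step\<close>

lemma extend_lipschitz_diamond_step:
  fixes \<phi> :: "vtx \<Rightarrow> real"
  assumes "at_level k E" and "\<And>a b. (a, b) \<in> E \<Longrightarrow> \<bar>\<phi> a - \<phi> b\<bar> \<le> c"
  obtains \<psi> where "\<And>x. x \<in> verts E \<Longrightarrow> \<psi> x = \<phi> x"
    and "\<And>a b. (a, b) \<in> diamond_step E \<Longrightarrow> \<bar>\<psi> a - \<psi> b\<bar> \<le> c / 2"
proof -
  \<comment> \<open>Averages on the new vertices halve the slope. The test on \<open>depth\<close>
    picks out the old vertices; \<open>Base n\<close> has depth 0 and falls under it, so the default
    0 is never taken.\<close>
  define \<psi> where "\<psi> x = (if depth x \<le> k then \<phi> x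
    else case x of Mid (u, v) i \<Rightarrow> (\<phi> u + \<phi> v) / 2 | _ \<Rightarrow> 0)" for x
  have old: "\<psi> x = \<phi> x" if "x \<in> verts E" for x
    using at_level_verts[OF assms(1) that] by (simp add: \<psi>_def)
  moreover have "\<bar>\<psi> a - \<psi> b\<bar> \<le> c / 2" if "(a, b) \<in> diamond_step E" for a b
    using that
  proof (cases rule: diamond_step_cases)
    case (1 u v i)
    have "\<psi> (Mid (u, v) i) = (\<phi> u + \<phi> v) / 2"
      using assms(1) 1(1) by (auto simp: \<psi>_def at_level_def)
    with 1 assms(2)[of u v] old edge_verts[of u v E] show ?thesis
      by (auto simp: abs_if split: if_splits)
  qed
  ultimately show ?thesis using that by blast
qed

text \<open>Linear interpolation along the four steps of the gadget; the two sides of the 4-cycle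
  receive the same value.\<close>

lemma extend_lipschitz_laakso_step:
  fixes \<phi> :: "vtx \<Rightarrow> real"
  assumes "at_level k E" and "\<And>a b. (a, b) \<in> E \<Longrightarrow> \<bar>\<phi> a - \<phi> b\<bar> \<le> c"
  obtains \<psi> where "\<And>x. x \<in> verts E \<Longrightarrow> \<psi> x = \<phi> x"
    and "\<And>a b. (a, b) \<in> laakso_step E \<Longrightarrow> \<bar>\<psi> a - \<psi> b\<bar> \<le> c / 4"
proof -
  define \<psi> where "\<psi> x = (if depth x \<le> k then \<phi> x
    else case x of Mid (u, v) i \<Rightarrow>
      if i = 2 then (3 * \<phi> u + \<phi> v) / 4 else if i = 5 then (\<phi> u + 3 * \<phi> v) / 4 else (\<phi> u + \<phi> v) / 2
    | _ \<Rightarrow> 0)" for x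
  have old: "\<psi> x = \<phi> x" if "x \<in> verts E" for x
    using at_level_verts[OF assms(1) that] by (simp add: \<psi>_def)
  have new: "\<psi> (Mid (u, v) 2) = (3 * \<phi> u + \<phi> v) / 4" "\<psi> (Mid (u, v) 3) = (\<phi> u + \<phi> v) / 2"
    "\<psi> (Mid (u, v) 4) = (\<phi> u + \<phi> v) / 2" "\<psi> (Mid (u, v) 5) = (\<phi> u + 3 * \<phi> v) / 4" if "(u, v) \<in> E" for u v
    using assms(1) that by (auto simp: \<psi>_def at_level_def)
  have "\<bar>\<psi> a - \<psi> b\<bar> \<le> c / 4" if "(a, b) \<in> laakso_step E" for a b
    using that
  proof (cases rule: laakso_step_cases)
    case (1 u v)
    then show ?thesis using assms(2)[of u v] new[of u v] old edge_verts[of u v E] by (simp add: abs_if split: if_splits)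
  next
    case (2 u v i)
    then show ?thesis using assms(2)[of u v] new[of u v] by (auto simp: abs_if split: if_splits)
  next
    case (3 u v i)
    then show ?thesis using assms(2)[of u v] new[of u v] by (auto simp: abs_if split: if_splits)
  next
    case (4 u v)
    then show ?thesis using assms(2)[of u v] new[of u v] old edge_verts[of u v E] by (simp add: abs_if split: if_splits)
  qed
  with old show ?thesis using that by blast
qed

section \<open>Cells of diamond graphs\<close>

text \<open>Refinement acts edge by edge. Hence \<open>diamond (k + i)\<close> is the union of
  cells, each grown out of one edge of \<open>diamond k\<close>, whose ends are the poles of the
  cell.\<close>

lemma funpow_diamond_step_UN: "(diamond_step ^^ i) E = (\<Union>e\<in>E. (diamond_step ^^ i) {e})"
proof (induction i)
  case (Suc i)
  have *: "diamond_step (\<Union>e\<in>E. F e) = (\<Union>e\<in>E. diamond_step (F e))" for F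
    by (auto simp: diamond_step_def)
  have "(diamond_step ^^ Suc i) E = diamond_step (\<Union>e\<in>E. (diamond_step ^^ i) {e})"
    using Suc by simp
  then show ?case
    by (simp add: *)
qed auto

lemma funpow_diamond_step_mono: "E \<subseteq> F \<Longrightarrow> (diamond_step ^^ i) E \<subseteq> (diamond_step ^^ i) F"
  using funpow_diamond_step_UN[of i E] funpow_diamond_step_UN[of i F] by blast

lemma diamond_add: "diamond (k + i) = (diamond_step ^^ i) (diamond k)"
  by (induction i) auto

lemma at_level_funpow_diamond_step: "at_level k E \<Longrightarrow> at_level (k + i) ((diamond_step ^^ i) E)"
  by (induction i) (auto simp: at_level_diamond_step)

lemma relpow_sym_edges_mono: "E \<subseteq> F \<Longrightarrow> (x, y) \<in> sym_edges E ^^ k \<Longrightarrow> (x, y) \<in> sym_edges F ^^ k"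
  using relpowp_mono[to_set, of "sym_edges E" "sym_edges F" x y k] sym_edges_mono[of E F] by auto

lemma relpow_trans: "(x, y) \<in> R ^^ a \<Longrightarrow> (y, z) \<in> R ^^ b \<Longrightarrow> (x, z) \<in> R ^^ (a + b)"
  by (auto simp: relpow_add)

text \<open>Here and in \<open>cell_pole_walks\<close> the first refinement is peeled off, not the
  last: a cell of order \<open>Suc i\<close> is a quadrilateral of cells of order
  \<open>i\<close>.\<close>

lemma cell_traverse: "(u, v) \<in> sym_edges ((diamond_step ^^ i) {(u, v)}) ^^ (2 ^ i)"
proof (induction i arbitrary: u v)
  case 0
  show ?case by (simp add: sym_edges_def)
next
  case (Suc i)
  let ?F = "(diamond_step ^^ Suc i) {(u, v)}"
  have sub: "(diamond_step ^^ i) {e} \<subseteq> ?F" if "e \<in> diamond_step {(u, v)}" for e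
    using funpow_diamond_step_mono[of "{e}" "diamond_step {(u, v)}" i] that
    by (simp add: funpow_Suc_right del: funpow.simps)
  have "(u, Mid (u, v) 0) \<in> sym_edges ?F ^^ (2 ^ i)"
    by (rule relpow_sym_edges_mono[OF sub Suc.IH]) (simp add: diamond_step_def)
  moreover have "(Mid (u, v) 0, v) \<in> sym_edges ?F ^^ (2 ^ i)"
    by (rule relpow_sym_edges_mono[OF sub Suc.IH]) (simp add: diamond_step_def)
  ultimately have "(u, v) \<in> sym_edges ?F ^^ (2 ^ i + 2 ^ i)"
    by (rule relpow_trans)
  then show ?case
    by (simp add: mult_2 del: funpow.simps)
qed

text \<open>Each vertex lies on a walk of length \<open>2 ^ i\<close> between the poles: by
  induction inside its subcell, continued across one more subcell towards the opposite pole.\<close>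

lemma cell_pole_walks:
  assumes "x \<in> verts ((diamond_step ^^ i) {(u, v)})"
  shows "\<exists>a b. a + b = 2 ^ i \<and> (x, u) \<in> sym_edges ((diamond_step ^^ i) {(u, v)}) ^^ a \<and>
    (x, v) \<in> sym_edges ((diamond_step ^^ i) {(u, v)}) ^^ b"
  using assms
proof (induction i arbitrary: u v)
  case 0
  let ?R = "sym_edges {(u, v)}"
  have "(u, u) \<in> ?R ^^ 0" "(v, v) \<in> ?R ^^ 0" "(u, v) \<in> ?R ^^ 1" "(v, u) \<in> ?R ^^ 1"
    by (auto simp: sym_edges_def)
  moreover have "x = u \<or> x = v" using 0 by (auto simp: verts_def)
  ultimately show ?case
    by (metis funpow_0 plus_nat.add_0 add_0_right power_0)
next
  case (Suc i)
  let ?F = "(diamond_step ^^ Suc i) {(u, v)}"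
  have eq: "?F = (\<Union>e\<in>diamond_step {(u, v)}. (diamond_step ^^ i) {e})"
    using funpow_diamond_step_UN[of i "diamond_step {(u, v)}"]
    by (simp add: funpow_Suc_right del: funpow.simps)
  then obtain y z where yz: "(y, z) \<in> diamond_step {(u, v)}" "x \<in> verts ((diamond_step ^^ i) {(y, z)})"
    using Suc.prems by (auto simp: verts_def)
  have sub: "(diamond_step ^^ i) {e} \<subseteq> ?F" if "e \<in> diamond_step {(u, v)}" for e
    using eq that by blast
  obtain a b where ab: "a + b = 2 ^ i" "(x, y) \<in> sym_edges ?F ^^ a" "(x, z) \<in> sym_edges ?F ^^ b"
    using Suc.IH[OF yz(2)] relpow_sym_edges_mono[OF sub[OF yz(1)]] by blast
  have tr: "(p, q) \<in> sym_edges ?F ^^ (2 ^ i)" "(q, p) \<in> sym_edges ?F ^^ (2 ^ i)"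
    if "(p, q) \<in> diamond_step {(u, v)}" for p q
    using relpow_sym_edges_mono[OF sub[OF that] cell_traverse] relpow_sym_edges_commute by blast+
  have arith: "a + (b + 2 ^ i) = 2 ^ Suc i" "(a + 2 ^ i) + b = 2 ^ Suc i"
    using ab(1) by auto
  from yz(1) show ?case
  proof (cases rule: diamond_step_cases)
    case (1 u' v' j)
    then have "u' = u" "v' = v" by auto
    note I = diamond_stepI[OF 1(1,2), unfolded this]
    from 1(3) show ?thesis
    proof
      assume "y = u' \<and> z = Mid (u', v') j"
      then have "y = u" "z = Mid (u, v) j" using 1 by auto
      then have "(x, u) \<in> sym_edges ?F ^^ a" "(x, v) \<in> sym_edges ?F ^^ (b + 2 ^ i)"
        using ab relpow_trans[OF _ tr(1)] I 1(1) by (auto simp del: funpow.simps)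
      with arith show ?thesis by blast
    next
      assume "y = Mid (u', v') j \<and> z = v'"
      then have "z = v" "y = Mid (u, v) j" using 1 by auto
      then have "(x, u) \<in> sym_edges ?F ^^ (a + 2 ^ i)" "(x, v) \<in> sym_edges ?F ^^ b"
        using ab relpow_trans[OF _ tr(2)] I 1(1) by (auto simp del: funpow.simps)
      with arith show ?thesis by blast
    qed
  qed
qed

text \<open>A common new vertex determines the edge it subdivides, so this edge lies in both cells.
  By induction its ends are poles, of depth at most \<open>k\<close>, while an edge of a cell of
  order \<open>i\<close> has an end of depth \<open>k + i\<close>. For \<open>i = 0\<close> the
  common edge contradicts \<open>e \<noteq> e'\<close>.\<close>

lemma cells_intersect_in_poles:
  assumes "at_level k E" "e \<in> E" "e' \<in> E" "e \<noteq> e'"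
  shows "verts ((diamond_step ^^ i) {e}) \<inter> verts ((diamond_step ^^ i) {e'}) \<subseteq> {fst e, snd e}"
proof (induction i)
  case 0
  show ?case by (auto simp: verts_def)
next
  case (Suc i)
  have lev: "at_level (k + j) ((diamond_step ^^ j) {g})" if "g \<in> E" for g j
    using at_level_funpow_diamond_step[of k "{g}" j] that assms(1) by (auto simp: at_level_def)
  show ?case
  proof
    fix x
    assume x: "x \<in> verts ((diamond_step ^^ Suc i) {e}) \<inter> verts ((diamond_step ^^ Suc i) {e'})"
    let ?A = "(diamond_step ^^ i) {e}" and ?B = "(diamond_step ^^ i) {e'}"
    have old_or_new: "x \<in> verts F \<or> (\<exists>u v j. (u, v) \<in> F \<and> x = Mid (u, v) j \<and> depth x = Suc (k + i))"
      if "x \<in> verts (diamond_step F)" "at_level (k + i) F" for F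
      using verts_diamond_step_cases[OF that(1)] that(2) by (auto simp: at_level_def)
    have A: "x \<in> verts ?A \<or> (\<exists>u v j. (u, v) \<in> ?A \<and> x = Mid (u, v) j \<and> depth x = Suc (k + i))"
      using old_or_new[OF _ lev[OF assms(2)]] x by simp
    have B: "x \<in> verts ?B \<or> (\<exists>u v j. (u, v) \<in> ?B \<and> x = Mid (u, v) j \<and> depth x = Suc (k + i))"
      using old_or_new[OF _ lev[OF assms(3)]] x by simp
    have dep: "depth x \<le> k + i" if "x \<in> verts ?A \<or> x \<in> verts ?B"
      using that at_level_verts[OF lev[OF assms(2)]] at_level_verts[OF lev[OF assms(3)]] by blast
    show "x \<in> {fst e, snd e}"
    proof (cases "depth x \<le> k + i")
      case True
      then show ?thesis using A B Suc.IH by auto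
    next
      case False
      then obtain u v where uv: "(u, v) \<in> ?A" "(u, v) \<in> ?B"
        using A B dep by auto
      have "i \<noteq> 0" using uv assms(4) by (intro notI) auto
      have "u \<in> {fst e, snd e}" "v \<in> {fst e, snd e}"
        using Suc.IH edge_verts uv by blast+
      then have "max (depth u) (depth v) \<le> k"
        using assms(1,2) by (auto simp: at_level_def)
      moreover have "max (depth u) (depth v) = k + i"
        using lev[OF assms(2), of i] uv(1) by (auto simp: at_level_def)
      ultimately show ?thesis using \<open>i \<noteq> 0\<close> by simp
    qed
  qed
qed

text \<open>These are the properties of a cell that forks need. That the cell is left only through
  its poles is expressed metrically: leaving \<open>S\<close> costs at least the distance to one of
  them.\<close>

lemma diamond_cell:
  assumes "p \<in> verts (diamond (k + i))"
  obtains S u v where "u \<in> verts (diamond k)" "v \<in> verts (diamond k)" "p \<in> S"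
    "S \<subseteq> verts (diamond (k + i))"
    "\<And>x. x \<in> S \<Longrightarrow> gdist (diamond (k + i)) x u + gdist (diamond (k + i)) x v \<le> 2 ^ i"
    "\<And>x y. x \<in> S \<Longrightarrow> y \<in> verts (diamond (k + i)) - S \<Longrightarrow>
      gdist (diamond (k + i)) x u \<le> gdist (diamond (k + i)) x y \<or>
      gdist (diamond (k + i)) x v \<le> gdist (diamond (k + i)) x y"
proof -
  let ?G = "diamond (k + i)"
  define cell where "cell e = (diamond_step ^^ i) {e}" for e
  have G: "?G = (\<Union>e\<in>diamond k. cell e)"
    unfolding diamond_add cell_def by (rule funpow_diamond_step_UN)
  then obtain u v where uv: "(u, v) \<in> diamond k" "p \<in> verts (cell (u, v))"
    using assms by (auto simp: verts_def)
  define S where "S = verts (cell (u, v))"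
  have sub: "cell (u, v) \<subseteq> ?G" using G uv(1) by blast
  have SG: "S \<subseteq> verts ?G"
    unfolding S_def using verts_mono[OF sub] .
  have poles: "u \<in> verts (diamond k)" "v \<in> verts (diamond k)"
    using edge_verts uv(1) by blast+
  have polesG: "u \<in> verts ?G" "v \<in> verts ?G"
    using poles verts_diamond_mono[of k "k + i"] by auto
  have sum: "gdist ?G x u + gdist ?G x v \<le> 2 ^ i" if x: "x \<in> S" for x
  proof -
    obtain a b where ab: "a + b = 2 ^ i" "(x, u) \<in> sym_edges (cell (u, v)) ^^ a"
      "(x, v) \<in> sym_edges (cell (u, v)) ^^ b"
      using cell_pole_walks x unfolding S_def cell_def by blast
    have "gdist ?G x u \<le> a" "gdist ?G x v \<le> b"
      using ab(2,3) relpow_sym_edges_mono[OF sub] gdist_le by blast+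
    then show ?thesis using ab(1) by linarith
  qed
  have exit: "gdist ?G x u \<le> gdist ?G x y \<or> gdist ?G x v \<le> gdist ?G x y"
    if x: "x \<in> S" and y: "y \<in> verts ?G - S" for x y
  proof -
    \<comment> \<open>Distance to the nearer pole inside \<open>S\<close>, continued by 0. Other
      cells meet \<open>S\<close> only in poles, where the value is 0 as well, so it varies by at
      most 1 along every edge; its value at \<open>x\<close> bounds the distance to any vertex
      outside \<open>S\<close> from below.\<close>
    define \<phi> where "\<phi> z = (if z \<in> S then real (min (gdist ?G z u) (gdist ?G z v)) else 0)" for z
    have "\<bar>\<phi> a - \<phi> b\<bar> \<le> 1" if ab: "(a, b) \<in> ?G" for a b
    proof -
      obtain e where e: "e \<in> diamond k" "(a, b) \<in> cell e"
        using ab G by blast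
      show ?thesis
      proof (cases "e = (u, v)")
        case True
        then have S: "a \<in> S" "b \<in> S" using e edge_verts unfolding S_def by blast+
        have "a \<in> verts ?G" "b \<in> verts ?G" using S SG by auto
        then have "gdist ?G a w \<le> gdist ?G b w + 1" "gdist ?G b w \<le> gdist ?G a w + 1"
          if "w \<in> verts ?G" for w
          using gdist_triangle[OF connected_diamond, of a "k + i" b w]
            gdist_triangle[OF connected_diamond, of b "k + i" a w]
            gdist_edge[OF ab] gdist_commute[of ?G a b] that by auto
        from this[OF polesG(1)] this[OF polesG(2)] S show ?thesis
          by (auto simp: \<phi>_def min_def)
      next
        case False
        have "z = u \<or> z = v" if "z \<in> S" "z \<in> verts (cell e)" for z
          using cells_intersect_in_poles[OF at_level_diamond uv(1) e(1), of i] False that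
          unfolding S_def cell_def by auto
        then have "\<phi> z = 0" if "z \<in> verts (cell e)" for z
          using that by (fastforce simp: \<phi>_def)
        then show ?thesis using edge_verts[OF e(2)] by simp
      qed
    qed
    then have "\<bar>\<phi> x - \<phi> y\<bar> \<le> 1 * real (gdist ?G x y)"
      using x y SG by (intro lipschitz_gdist connected_diamond) auto
    then show ?thesis
      using x y by (auto simp: \<phi>_def min_def split: if_splits)
  qed
  show ?thesis
    using that[OF poles _ SG sum exit] uv(2) S_def by blast
qed

section \<open>Lipschitz extension through several levels\<close>

lemma extend_lipschitz_diamond:
  fixes \<phi> :: "vtx \<Rightarrow> real"
  assumes "\<And>a b. (a, b) \<in> diamond k \<Longrightarrow> \<bar>\<phi> a - \<phi> b\<bar> \<le> c"
  shows "\<exists>\<psi>. (\<forall>x\<in>verts (diamond k). \<psi> x = \<phi> x) \<and> (\<forall>(a, b)\<in>diamond (k + i). \<bar>\<psi> a - \<psi> b\<bar> \<le> c / 2 ^ i)"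
proof (induction i)
  case 0
  then show ?case using assms by (intro exI[of _ \<phi>]) auto
next
  case (Suc i)
  then obtain \<psi> where \<psi>: "\<forall>x\<in>verts (diamond k). \<psi> x = \<phi> x"
    "\<And>a b. (a, b) \<in> diamond (k + i) \<Longrightarrow> \<bar>\<psi> a - \<psi> b\<bar> \<le> c / 2 ^ i" by blast
  obtain \<chi> where "\<And>x. x \<in> verts (diamond (k + i)) \<Longrightarrow> \<chi> x = \<psi> x"
    "\<And>a b. (a, b) \<in> diamond_step (diamond (k + i)) \<Longrightarrow> \<bar>\<chi> a - \<chi> b\<bar> \<le> c / 2 ^ i / 2"
    by (rule extend_lipschitz_diamond_step[OF at_level_diamond, of "k + i" \<psi> "c / 2 ^ i", OF \<psi>(2)]) blast+
  with \<psi>(1) show ?case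
    using verts_diamond_mono[of k "k + i"] by (intro exI[of _ \<chi>]) (auto simp: mult.commute)
qed

lemma extend_lipschitz_laakso:
  fixes \<phi> :: "vtx \<Rightarrow> real"
  assumes "\<And>a b. (a, b) \<in> laakso k \<Longrightarrow> \<bar>\<phi> a - \<phi> b\<bar> \<le> c"
  shows "\<exists>\<psi>. (\<forall>x\<in>verts (laakso k). \<psi> x = \<phi> x) \<and> (\<forall>(a, b)\<in>laakso (k + i). \<bar>\<psi> a - \<psi> b\<bar> \<le> c / 4 ^ i)"
proof (induction i)
  case 0
  then show ?case using assms by (intro exI[of _ \<phi>]) auto
next
  case (Suc i)
  then obtain \<psi> where \<psi>: "\<forall>x\<in>verts (laakso k). \<psi> x = \<phi> x"
    "\<And>a b. (a, b) \<in> laakso (k + i) \<Longrightarrow> \<bar>\<psi> a - \<psi> b\<bar> \<le> c / 4 ^ i" by blast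
  obtain \<chi> where "\<And>x. x \<in> verts (laakso (k + i)) \<Longrightarrow> \<chi> x = \<psi> x"
    "\<And>a b. (a, b) \<in> laakso_step (laakso (k + i)) \<Longrightarrow> \<bar>\<chi> a - \<chi> b\<bar> \<le> c / 4 ^ i / 4"
    by (rule extend_lipschitz_laakso_step[OF at_level_laakso, of "k + i" \<psi> "c / 4 ^ i", OF \<psi>(2)]) blast+
  with \<psi>(1) show ?case
    using verts_laakso_mono[of k "k + i"] by (intro exI[of _ \<chi>]) (auto simp: mult.commute)
qed

text \<open>The indicator of \<open>x\<close> varies by at most 1 along edges of
  \<open>diamond k\<close>. Extended by \<open>i\<close> levels it varies by at most
  \<open>1 / 2 ^ i\<close> per edge, yet still by 1 between \<open>x\<close> and
  \<open>y\<close>.\<close>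

lemma gdist_diamond_separated:
  assumes "x \<in> verts (diamond k)" "y \<in> verts (diamond k)" "x \<noteq> y"
  shows "2 ^ i \<le> gdist (diamond (k + i)) x y"
proof -
  define \<phi> :: "vtx \<Rightarrow> real" where "\<phi> z = (if z = x then 1 else 0)" for z
  obtain \<psi> where \<psi>: "\<forall>x\<in>verts (diamond k). \<psi> x = \<phi> x"
    "\<And>a b. (a, b) \<in> diamond (k + i) \<Longrightarrow> \<bar>\<psi> a - \<psi> b\<bar> \<le> 1 / 2 ^ i"
    using extend_lipschitz_diamond[of k \<phi> 1 i] by (force simp: \<phi>_def)
  have "x \<in> verts (diamond (k + i))" "y \<in> verts (diamond (k + i))"
    using assms verts_diamond_mono[of k "k + i"] by auto
  then have "\<bar>\<psi> x - \<psi> y\<bar> \<le> 1 / 2 ^ i * real (gdist (diamond (k + i)) x y)"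
    using \<psi>(2) by (intro lipschitz_gdist connected_diamond)
  then have "\<bar>\<phi> x - \<phi> y\<bar> \<le> real (gdist (diamond (k + i)) x y) / 2 ^ i"
    using \<psi>(1) assms by simp
  then have "2 ^ i \<le> real (gdist (diamond (k + i)) x y)"
    using assms(3) by (simp add: \<phi>_def field_simps)
  then show ?thesis
    by (metis of_nat_le_iff of_nat_numeral of_nat_power)
qed

section \<open>Forks\<close>

lemma exit_step:
  fixes Z :: "nat \<Rightarrow> 'a"
  assumes "Z a \<in> S" "Z b \<notin> S" "a \<le> b"
  obtains t where "a \<le> t" "t < b" "Z t \<in> S" "Z (Suc t) \<notin> S"
proof -
  have "\<exists>t. a \<le> t \<and> t < b \<and> Z t \<in> S \<and> Z (Suc t) \<notin> S"
    using assms(3,2)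
  proof (induction rule: dec_induct)
    case base
    then show ?case using assms(1) by simp
  next
    case (step n)
    then show ?case by (metis less_Suc_eq)
  qed
  then show ?thesis using that by blast
qed

text \<open>A geodesic at scale \<open>w\<close>, up to a loss of a single step \<open>w\<close>
  that does not grow with the length.\<close>

definition efficient :: "('a \<Rightarrow> 'a \<Rightarrow> real) \<Rightarrow> real \<Rightarrow> nat \<Rightarrow> (nat \<Rightarrow> 'a) \<Rightarrow> bool" where
  "efficient D w T Z \<longleftrightarrow> (\<forall>i j. i \<le> j \<longrightarrow> j \<le> T \<longrightarrow>
     w * (real j - real i - 1) \<le> D (Z i) (Z j) \<and> D (Z i) (Z j) \<le> w * (real j - real i))"

lemma efficient_rev:
  assumes "efficient D w T Z" and "\<And>x y. D x y = D y x"
  shows "efficient D w T (\<lambda>t. Z (T - t))"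
  unfolding efficient_def
proof (intro allI impI)
  fix i j assume "i \<le> j" "j \<le> T"
  then show "w * (real j - real i - 1) \<le> D (Z (T - i)) (Z (T - j)) \<and>
      D (Z (T - i)) (Z (T - j)) \<le> w * (real j - real i)"
    using assms(1)[unfolded efficient_def, rule_format, of "T - j" "T - i"] assms(2)[of "Z (T - i)"]
    by (simp add: of_nat_diff)
qed

text \<open>The stem runs from \<open>Z 0\<close> to the branch point \<open>Z c\<close>; from there
  the prongs \<open>Z\<close> and \<open>Z'\<close> follow the two sides of a cycle and meet again
  after \<open>l\<close> steps. By \<open>sep\<close> a point of one prong is away from the other in
  proportion to its distance from the nearer end of the cycle. \<open>S\<close> will be the cell
  containing the branch point.\<close>

locale fork =
  fixes D :: "'a \<Rightarrow> 'a \<Rightarrow> real" and V S :: "'a set" and w C :: real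
    and T c l :: nat and Z Z' :: "nat \<Rightarrow> 'a"
  assumes triangle: "\<And>x y z. x \<in> V \<Longrightarrow> y \<in> V \<Longrightarrow> z \<in> V \<Longrightarrow> D x z \<le> D x y + D y z"
    and commute: "\<And>x y. D x y = D y x"
    and S_sub: "S \<subseteq> V"
    and w_pos: "w > 0" and C_ge: "C \<ge> 1"
    and Z_in: "\<And>i. i \<le> T \<Longrightarrow> Z i \<in> V" and Z'_in: "\<And>i. i \<le> T \<Longrightarrow> Z' i \<in> V"
    and Z_eff: "efficient D w T Z" and Z'_eff: "efficient D w T Z'"
    and l_le: "c + l \<le> T"
    and agree: "\<And>i. i \<le> c \<Longrightarrow> Z' i = Z i" and meet: "Z' (c + l) = Z (c + l)"
    and sep: "\<And>i j. c \<le> i \<Longrightarrow> i \<le> c + l \<Longrightarrow> c \<le> j \<Longrightarrow> j \<le> c + l \<Longrightarrow>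
      w * min (real i - real c) (real c + real l - real i) \<le> C * D (Z i) (Z' j)"
    and start: "Z c \<in> S"
begin

text \<open>Suppose that the stem passes \<open>u\<close> and the branch point is far from both
  poles. Then both prongs leave \<open>S\<close> next to \<open>v\<close>, although they are close
  to each other only near the ends of the cycle. An exit near the branch point contradicts the
  distance to \<open>v\<close>, one near the far end the distance to \<open>u\<close>.\<close>

lemma near_pole_aux:
  assumes uv: "u \<in> V" "v \<in> V"
    and sum: "\<And>x. x \<in> S \<Longrightarrow> D x u + D x v \<le> s"
    and exit: "\<And>x y. x \<in> S \<Longrightarrow> y \<in> V - S \<Longrightarrow> D x u \<le> D x y \<or> D x v \<le> D x y"
    and s: "s \<le> w * real l + E" and E: "E \<ge> 0"
    and t: "t \<le> c" "D (Z t) u \<le> w"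
  shows "D (Z c) u \<le> E + (2 * C + 5) * w \<or> D (Z c) v \<le> E + (2 * C + 5) * w"
proof (rule ccontr)
  assume "\<not> ?thesis"
  then have far: "D (Z c) u > E + (2 * C + 5) * w" "D (Z c) v > E + (2 * C + 5) * w" by auto
  note Zd = Z_eff[unfolded efficient_def, rule_format]
  note Z'd = Z'_eff[unfolded efficient_def, rule_format]
  have V: "Z t \<in> V" "Z c \<in> V" "Z (c + l) \<in> V" using Z_in l_le t by auto
  have Cw: "C * w \<ge> w" using C_ge w_pos by simp
  have "D (Z c) u \<le> D (Z t) (Z c) + D (Z t) u"
    using triangle[OF V(2,1) uv(1)] commute[of "Z c"] by simp
  also have "\<dots> \<le> w * (real c - real t) + w"
    using Zd[of t c] t l_le by auto
  finally have tc: "w * (real c - real t) > E + 2 * (C * w) + 4 * w"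
    using far(1) by (simp add: algebra_simps)
  \<comment> \<open>In \<open>S\<close> the common end of the prongs would be within
    \<open>s\<close> of \<open>u\<close>, hence within \<open>s + w\<close> of \<open>Z t\<close>;
    efficiency puts it at about \<open>w * (l + c - t)\<close>, which is more by
    \<open>tc\<close>.\<close>
  have out: "Z (c + l) \<notin> S"
  proof
    assume "Z (c + l) \<in> S"
    then have "D (Z (c + l)) u + D (Z (c + l)) v \<le> s" by (rule sum)
    moreover have "D (Z (c + l)) v \<ge> 0"
      using triangle[OF uv(2) V(3) uv(2)] triangle[OF uv(2) uv(2) uv(2)] commute[of v "Z (c + l)"] by linarith
    moreover have "D (Z t) (Z (c + l)) \<le> D (Z t) u + D (Z (c + l)) u"
      using triangle[OF V(1) uv(1) V(3)] commute[of u] by simp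
    moreover have "w * (real (c + l) - real t - 1) \<le> D (Z t) (Z (c + l))"
      using Zd[of t "c + l"] t l_le by auto
    ultimately have "w * (real (c + l) - real t - 1) - w \<le> w * real l + E"
      using s t by linarith
    then show False using tc Cw w_pos by (simp add: algebra_simps)
  qed
  \<comment> \<open>A prong exits within \<open>w\<close> of a pole. This is not \<open>u\<close>:
    the stem was there at time \<open>t\<close>, and an efficient chain cannot return.\<close>
  have leg: "\<exists>i. c \<le> i \<and> i \<le> c + l \<and> D (Y i) v \<le> w"
    if Yd: "\<And>i j. i \<le> j \<Longrightarrow> j \<le> T \<Longrightarrow> w * (real j - real i - 1) \<le> D (Y i) (Y j) \<and> D (Y i) (Y j) \<le> w * (real j - real i)"
      and YV: "\<And>i. i \<le> T \<Longrightarrow> Y i \<in> V" and Y: "Y t = Z t" "Y c = Z c" "Y (c + l) = Z (c + l)" for Y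
  proof -
    obtain i where i: "c \<le> i" "i < c + l" "Y i \<in> S" "Y (Suc i) \<notin> S"
      using exit_step[of Y c S "c + l"] start out Y by auto
    have YiV: "Y i \<in> V" "Y (Suc i) \<in> V" using YV i l_le by auto
    have "D (Y i) (Y (Suc i)) \<le> w"
      using Yd[of i "Suc i"] i l_le by auto
    then have "D (Y i) u \<le> w \<or> D (Y i) v \<le> w"
      using exit[of "Y i" "Y (Suc i)"] i YiV by auto
    moreover have "\<not> D (Y i) u \<le> w"
    proof
      assume "D (Y i) u \<le> w"
      moreover have "D (Z t) (Y i) \<le> D (Z t) u + D (Y i) u"
        using triangle[OF V(1) uv(1) YiV(1)] commute[of u] by simp
      moreover have "w * (real i - real t - 1) \<le> D (Z t) (Y i)"
        using Yd[of t i] t i l_le Y by auto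
      ultimately have "w * (real i - real t - 1) \<le> 2 * w" using t by linarith
      moreover have "w * (real c - real t) \<le> w * (real i - real t)"
        using i w_pos by simp
      ultimately show False
        using tc Cw E w_pos C_ge by (simp only: right_diff_distrib mult_1_right)
    qed
    ultimately show ?thesis using i by auto
  qed
  obtain i where i: "c \<le> i" "i \<le> c + l" "D (Z i) v \<le> w"
    using leg[OF Zd Z_in] by auto
  obtain j where j: "c \<le> j" "j \<le> c + l" "D (Z' j) v \<le> w"
    using leg[OF Z'd Z'_in] agree t meet by auto
  have ZiV: "Z i \<in> V" "Z' j \<in> V" using Z_in Z'_in i j l_le by auto
  have "D (Z i) (Z' j) \<le> 2 * w"
    using triangle[of "Z i" v "Z' j"] ZiV uv i j commute[of v "Z' j"] by auto
  then have "w * min (real i - real c) (real c + real l - real i) \<le> C * (2 * w)"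
    using sep[OF i(1,2) j(1,2)] C_ge by (smt (verit) mult_left_mono)
  \<comment> \<open>Both exits are within \<open>w\<close> of \<open>v\<close>, so
    \<open>sep\<close> puts \<open>i\<close> within \<open>2 * C\<close> of the branch time
    \<open>c\<close> or of the end \<open>c + l\<close>.\<close>
  then have "w * (real i - real c) \<le> 2 * (C * w) \<or> w * (real c + real l - real i) \<le> 2 * (C * w)"
    by (auto simp: min_def split: if_splits)
  then show False
  proof
    assume "w * (real i - real c) \<le> 2 * (C * w)"
    moreover have "D (Z c) v \<le> D (Z c) (Z i) + D (Z i) v"
      using triangle ZiV V uv by blast
    moreover have "D (Z c) (Z i) \<le> w * (real i - real c)"
      using Zd[of c i] i l_le by auto
    ultimately show False using far(2) i(3) E w_pos by (simp add: algebra_simps)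
  next
    \<comment> \<open>Now \<open>v\<close> is at distance about \<open>w * l\<close> from the branch
      point, and the bound \<open>s\<close> on the sum leaves at most \<open>E\<close> plus a
      multiple of \<open>w\<close> for \<open>u\<close>.\<close>
    assume "w * (real c + real l - real i) \<le> 2 * (C * w)"
    moreover have "D (Z c) (Z i) \<le> D (Z c) v + D (Z i) v"
      using triangle[OF V(2) uv(2) ZiV(1)] commute[of v] by simp
    moreover have "w * (real i - real c - 1) \<le> D (Z c) (Z i)"
      using Zd[of c i] i l_le by auto
    moreover have "D (Z c) u + D (Z c) v \<le> s" by (rule sum[OF start])
    ultimately show False using far(1) i(3) s w_pos by (simp add: algebra_simps)
  qed
qed

text \<open>The stem of the fork and its two prongs all leave \<open>S\<close>, and do so close to one of two poles;
  two branches that leave close to the same pole must do so close to the branch point.\<close>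

lemma near_pole:
  assumes uv: "u \<in> V" "v \<in> V"
    and sum: "\<And>x. x \<in> S \<Longrightarrow> D x u + D x v \<le> s"
    and exit: "\<And>x y. x \<in> S \<Longrightarrow> y \<in> V - S \<Longrightarrow> D x u \<le> D x y \<or> D x v \<le> D x y"
    and s: "s \<le> w * real l + E" "s < w * (real c - 1)" and E: "E \<ge> 0"
  shows "D (Z c) u \<le> E + (2 * C + 5) * w \<or> D (Z c) v \<le> E + (2 * C + 5) * w"
proof -
  note Zd = Z_eff[unfolded efficient_def, rule_format]
  have V: "Z 0 \<in> V" "Z c \<in> V" using Z_in l_le by auto
  \<comment> \<open>Adding the triangle inequalities through \<open>u\<close> and through
    \<open>v\<close> shows that two points of \<open>S\<close> are at distance at most
    \<open>s\<close>; the stem is longer.\<close>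
  have out: "Z 0 \<notin> S"
  proof
    assume "Z 0 \<in> S"
    then have "D (Z 0) u + D (Z 0) v \<le> s" by (rule sum)
    moreover have "D (Z c) u + D (Z c) v \<le> s" by (rule sum[OF start])
    moreover have "D (Z 0) (Z c) \<le> D (Z 0) u + D (Z c) u" "D (Z 0) (Z c) \<le> D (Z 0) v + D (Z c) v"
      using triangle[OF V(1) uv(1) V(2)] triangle[OF V(1) uv(2) V(2)] commute[of _ "Z c"] by simp_all
    moreover have "w * (real c - 1) \<le> D (Z 0) (Z c)"
      using Zd[of 0 c] l_le by auto
    ultimately show False using s(2) by linarith
  qed
  obtain i where i: "i < c" "Z (c - i) \<in> S" "Z (c - Suc i) \<notin> S"
    using exit_step[of "\<lambda>i. Z (c - i)" 0 S c] start out by auto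
  have ZiV: "Z (c - i) \<in> V" "Z (c - Suc i) \<in> V" using Z_in l_le by auto
  have "D (Z (c - i)) (Z (c - Suc i)) \<le> w"
    using Zd[of "c - Suc i" "c - i"] i l_le commute by (auto simp: of_nat_diff)
  then consider "D (Z (c - i)) u \<le> w" | "D (Z (c - i)) v \<le> w"
    using exit[of "Z (c - i)" "Z (c - Suc i)"] i ZiV by auto
  then show ?thesis
  proof cases
    case 1
    then show ?thesis using near_pole_aux[OF uv sum exit s(1) E, of "c - i"] by simp
  next
    case 2
    have "D x v + D x u \<le> s" if "x \<in> S" for x using sum[OF that] by simp
    moreover have "D x v \<le> D x y \<or> D x u \<le> D x y" if "x \<in> S" "y \<in> V - S" for x y
      using exit[OF that] by blast
    ultimately show ?thesis using near_pole_aux[OF uv(2,1) _ _ s(1) E, of "c - i"] 2 by auto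
  qed
qed

end

section \<open>Chains in Laakso graphs\<close>

text \<open>Replaces each edge of a chain by a path of four edges through its gadget;
  \<open>c b\<close>, meant to be 3 or 4, picks the side of the 4-cycle in the gadget of the
  \<open>b\<close>-th edge.\<close>

definition refine :: "(nat \<Rightarrow> nat) \<Rightarrow> (nat \<Rightarrow> vtx) \<Rightarrow> nat \<Rightarrow> vtx" where
  "refine c Y t = (if t mod 4 = 0 then Y (t div 4)
     else Mid (Y (t div 4), Y (Suc (t div 4)))
       (if t mod 4 = 1 then 2 else if t mod 4 = 2 then c (t div 4) else 5))"

lemma refine_edges:
  assumes "\<And>t. t < q \<Longrightarrow> (Y t, Y (Suc t)) \<in> E" "\<And>b. c b = 3 \<or> c b = 4" "t < 4 * q"
  shows "(refine c Y t, refine c Y (Suc t)) \<in> laakso_step E"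
proof -
  define b where "b = t div 4"
  have e: "(Y b, Y (Suc b)) \<in> E" using assms(1,3) by (auto simp: b_def)
  note I = laakso_stepI(1,2)[OF e] laakso_stepI(3,4)[OF e assms(2)[of b]]
  consider "t = 4 * b" | "t = 4 * b + 1" | "t = 4 * b + 2" | "t = 4 * b + 3"
    unfolding b_def by linarith
  then show ?thesis
  proof cases
    case 1
    then have "Suc t div 4 = b" "Suc t mod 4 = 1" "t div 4 = b" "t mod 4 = 0" by presburger+
    then show ?thesis using I by (simp add: refine_def)
  next
    case 2
    then have "Suc t div 4 = b" "Suc t mod 4 = 2" "t div 4 = b" "t mod 4 = 1" by presburger+
    then show ?thesis using I by (simp add: refine_def)
  next
    case 3
    then have "Suc t div 4 = b" "Suc t mod 4 = 3" "t div 4 = b" "t mod 4 = 2" by presburger+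
    then show ?thesis using I by (simp add: refine_def)
  next
    case 4
    then have "Suc t div 4 = Suc b" "Suc t mod 4 = 0" "t div 4 = b" "t mod 4 = 3" by presburger+
    then show ?thesis using I by (simp add: refine_def)
  qed
qed

lemma refine_funpow_edges:
  assumes "\<And>t. t < q \<Longrightarrow> (Y t, Y (Suc t)) \<in> laakso l" "t < q * 4 ^ i"
  shows "((refine (\<lambda>_. 3) ^^ i) Y t, (refine (\<lambda>_. 3) ^^ i) Y (Suc t)) \<in> laakso (l + i)"
  using assms(2)
proof (induction i arbitrary: t)
  case 0
  then show ?case using assms(1) by simp
next
  case (Suc i)
  have "(refine (\<lambda>_. 3) ((refine (\<lambda>_. 3) ^^ i) Y) t, refine (\<lambda>_. 3) ((refine (\<lambda>_. 3) ^^ i) Y) (Suc t))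
      \<in> laakso_step (laakso (l + i))"
    by (rule refine_edges[of "q * 4 ^ i"]) (use Suc in auto)
  then show ?case by simp
qed

lemma refine_funpow_mult: "(refine (\<lambda>_. 3) ^^ i) Y (4 ^ i * t) = Y t"
  by (induction i arbitrary: t) (auto simp: refine_def mult.assoc)

lemma refine_funpow_agree_le:
  assumes "\<And>t. t \<le> q \<Longrightarrow> Y t = Y' t" "t \<le> q * 4 ^ i"
  shows "(refine (\<lambda>_. 3) ^^ i) Y t = (refine (\<lambda>_. 3) ^^ i) Y' t"
  using assms(2)
proof (induction i arbitrary: t)
  case (Suc i)
  \<comment> \<open>A vertex inside a block of four depends on both ends of the block, so the right
    end must also stay in the range of agreement.\<close>
  have "t \<le> 4 * N \<Longrightarrow> t div 4 \<le> N \<and> (t mod 4 = 0 \<or> Suc (t div 4) \<le> N)" for N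
    by presburger
  from this[of "q * 4 ^ i"]
  have "t div 4 \<le> q * 4 ^ i" "t mod 4 = 0 \<or> Suc (t div 4) \<le> q * 4 ^ i"
    using Suc.prems by auto
  then show ?case using Suc.IH by (auto simp: refine_def)
qed (use assms(1) in auto)

lemma refine_funpow_agree_ge:
  assumes "\<And>t. t \<ge> q \<Longrightarrow> Y t = Y' t" "t \<ge> q * 4 ^ i"
  shows "(refine (\<lambda>_. 3) ^^ i) Y t = (refine (\<lambda>_. 3) ^^ i) Y' t"
  using assms(2)
proof (induction i arbitrary: t)
  case (Suc i)
  have "t div 4 \<ge> q * 4 ^ i"
    using Suc.prems by auto
  then show ?case using Suc.IH by (auto simp: refine_def)
qed (use assms(1) in auto)

lemma chain_in_verts:
  assumes "\<And>t. t < T \<Longrightarrow> (Z t, Z (Suc t)) \<in> E" "0 < T" "t \<le> T"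
  shows "Z t \<in> verts E"
proof (cases t)
  case 0
  then show ?thesis using assms(1)[of 0] assms(2) edge_verts by blast
next
  case (Suc s)
  then show ?thesis using assms(1)[of s] assms(3) edge_verts by fastforce
qed

text \<open>The function that is 1 at the midpoint of one side, -1 at that of the other and 0
  elsewhere varies by at most 1 per edge, as the midpoints are not adjacent. Its extension is at
  least \<open>1 - \<bar>t - t0\<bar> / 4 ^ i\<close> on \<open>Z\<close> and at most 0 on
  \<open>Z'\<close> near the midpoint. Extending by \<open>i\<close> levels serves the chains, by
  \<open>j\<close> more the graph in which the distance is taken.\<close>

lemma cycle_sides_separated:
  assumes e: "(a, b) \<in> laakso l"
    and Z: "\<And>t. t < T \<Longrightarrow> (Z t, Z (Suc t)) \<in> laakso (Suc l + i)" "Z t0 = Mid (a, b) 3"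
    and Z': "\<And>t. t < T \<Longrightarrow> (Z' t, Z' (Suc t)) \<in> laakso (Suc l + i)" "Z' t0 = Mid (a, b) 4"
    and t: "0 < T" "t0 \<le> T" "t \<le> T" "t' \<le> T" and near: "\<bar>real t' - real t0\<bar> \<le> 4 ^ i"
  shows "4 ^ j * (4 ^ i - \<bar>real t - real t0\<bar>) \<le> real (gdist (laakso (Suc l + i + j)) (Z t) (Z' t'))"
proof -
  define \<phi> :: "vtx \<Rightarrow> real" where
    "\<phi> x = (if x = Mid (a, b) 3 then 1 else if x = Mid (a, b) 4 then -1 else 0)" for x
  have "\<bar>\<phi> x - \<phi> y\<bar> \<le> 1" if "(x, y) \<in> laakso (Suc l)" for x y
    using that[simplified] by (cases rule: laakso_step_cases) (auto simp: \<phi>_def)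
  then obtain \<psi> where \<psi>: "\<forall>x\<in>verts (laakso (Suc l)). \<psi> x = \<phi> x"
    "\<And>x y. (x, y) \<in> laakso (Suc l + i) \<Longrightarrow> \<bar>\<psi> x - \<psi> y\<bar> \<le> 1 / 4 ^ i"
    using extend_lipschitz_laakso[of "Suc l" \<phi> 1 i] by blast
  then obtain \<chi> where \<chi>: "\<forall>x\<in>verts (laakso (Suc l + i)). \<chi> x = \<psi> x"
    "\<And>x y. (x, y) \<in> laakso (Suc l + i + j) \<Longrightarrow> \<bar>\<chi> x - \<chi> y\<bar> \<le> 1 / 4 ^ i / 4 ^ j"
    using extend_lipschitz_laakso[of "Suc l + i" \<psi> "1 / 4 ^ i" j] by blast
  have mid: "Mid (a, b) 3 \<in> verts (laakso (Suc l))" "Mid (a, b) 4 \<in> verts (laakso (Suc l))"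
    using laakso_stepI(3)[OF e, of 3, THEN edge_verts] laakso_stepI(3)[OF e, of 4, THEN edge_verts] by simp_all
  have lip: "\<bar>\<psi> (Y s) - \<psi> (Y t0)\<bar> \<le> 1 / 4 ^ i * \<bar>real s - real t0\<bar>"
    if Y: "\<And>t. t < T \<Longrightarrow> (Y t, Y (Suc t)) \<in> laakso (Suc l + i)" and s: "s \<le> T" for Y s
    using lipschitz_chain[of "laakso (Suc l + i)" \<psi> "1 / 4 ^ i" T Y s t0, OF \<psi>(2) Y]
      lipschitz_chain[of "laakso (Suc l + i)" \<psi> "1 / 4 ^ i" T Y t0 s, OF \<psi>(2) Y] s t(2)
    by (cases "s \<le> t0") (auto simp: abs_minus_commute)
  have V: "Z t \<in> verts (laakso (Suc l + i))" "Z' t' \<in> verts (laakso (Suc l + i))"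
    using chain_in_verts[of T Z] chain_in_verts[of T Z'] Z Z' t by blast+
  have sub: "verts (laakso (Suc l + i)) \<subseteq> verts (laakso (Suc l + i + j))"
    by (rule verts_laakso_mono) simp
  have "1 - \<bar>real t - real t0\<bar> / 4 ^ i \<le> \<psi> (Z t)"
    using lip[of Z t, OF Z(1) t(3)] Z(2) \<psi>(1) mid by (simp add: \<phi>_def)
  moreover have "\<psi> (Z' t') \<le> 0"
  proof -
    have "1 / 4 ^ i * \<bar>real t' - real t0\<bar> \<le> 1" using near by simp
    moreover have "\<psi> (Z' t0) = -1" using Z'(2) \<psi>(1) mid by (simp add: \<phi>_def)
    ultimately show ?thesis
      using lip[of Z' t', OF Z'(1) t(4)] by linarith
  qed
  moreover have "\<bar>\<chi> (Z t) - \<chi> (Z' t')\<bar> \<le> 1 / 4 ^ i / 4 ^ j * real (gdist (laakso (Suc l + i + j)) (Z t) (Z' t'))"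
    using V sub \<chi>(2) by (intro lipschitz_gdist connected_laakso) auto
  ultimately have "1 - \<bar>real t - real t0\<bar> / 4 ^ i \<le>
      real (gdist (laakso (Suc l + i + j)) (Z t) (Z' t')) / (4 ^ i * 4 ^ j)"
    using \<chi>(1) V by simp
  then have "(4 ^ i * 4 ^ j) * (1 - \<bar>real t - real t0\<bar> / 4 ^ i) \<le>
      real (gdist (laakso (Suc l + i + j)) (Z t) (Z' t'))"
    by (simp add: pos_le_divide_eq mult.commute)
  then show ?thesis
    by (simp add: algebra_simps)
qed

section \<open>Global distance bounds, efficient chains, and forks in diamond graphs\<close>

lemma gdist_laakso_ends: "4 ^ n \<le> real (gdist (laakso n) (Base 0) (Base 1))"
proof -
  define \<phi> :: "vtx \<Rightarrow> real" where "\<phi> z = (if z = Base 0 then 1 else 0)" for z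
  obtain \<psi> where \<psi>: "\<forall>x\<in>verts (laakso 0). \<psi> x = \<phi> x"
    "\<And>a b. (a, b) \<in> laakso (0 + n) \<Longrightarrow> \<bar>\<psi> a - \<psi> b\<bar> \<le> 1 / 4 ^ n"
    using extend_lipschitz_laakso[of 0 \<phi> 1 n] by (force simp: \<phi>_def)
  have ends: "Base 0 \<in> verts (laakso 0)" "Base 1 \<in> verts (laakso 0)"
    by (auto simp: verts_def)
  then have "Base 0 \<in> verts (laakso n)" "Base 1 \<in> verts (laakso n)"
    using verts_laakso_mono[of 0 n] by auto
  then have "\<bar>\<psi> (Base 0) - \<psi> (Base 1)\<bar> \<le> 1 / 4 ^ n * real (gdist (laakso n) (Base 0) (Base 1))"
    using \<psi>(2) by (intro lipschitz_gdist connected_laakso) auto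
  then have "1 \<le> 1 / 4 ^ n * real (gdist (laakso n) (Base 0) (Base 1))"
    using \<psi>(1) ends by (simp add: \<phi>_def)
  then show ?thesis by (simp add: field_simps)
qed

lemma gdist_diamond_le:
  assumes "x \<in> verts (diamond m)" "y \<in> verts (diamond m)"
  shows "gdist (diamond m) x y \<le> 2 * 2 ^ m"
proof -
  have G: "diamond m = (diamond_step ^^ m) {(Base 0, Base 1)}"
    using diamond_add[of 0 m] by simp
  have "gdist (diamond m) z (Base 0) \<le> 2 ^ m" if "z \<in> verts (diamond m)" for z
    using cell_pole_walks[of z m "Base 0" "Base 1"] that gdist_le[of z "Base 0" _ "diamond m"]
    unfolding G[symmetric] by (metis le_add1 le_trans)
  from this[OF assms(1)] this[OF assms(2)] show ?thesis
    using gdist_triangle[OF connected_diamond assms(1) _ assms(2), of "Base 0"]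
      verts_diamond_mono[of 0 m] gdist_commute[of "diamond m" y]
    by (auto simp: verts_def)
qed

text \<open>The parts of the chain outside \<open>i\<close> to \<open>j\<close> have at most their
  full length, so the loss of at most \<open>w\<close> between the ends also bounds the loss on each
  subchain.\<close>

lemma efficient_chain:
  assumes triangle: "\<And>x y z. x \<in> V \<Longrightarrow> y \<in> V \<Longrightarrow> z \<in> V \<Longrightarrow> D x z \<le> D x y + D y z"
    and self: "\<And>x. D x x = 0"
    and V: "\<And>t. t \<le> T \<Longrightarrow> Z t \<in> V" and steps: "\<And>t. t < T \<Longrightarrow> D (Z t) (Z (Suc t)) \<le> w"
    and total: "w * (real T - 1) \<le> D (Z 0) (Z T)"
  shows "efficient D w T Z"
proof -
  have up: "D (Z i) (Z j) \<le> w * (real j - real i)" if "i \<le> j" "j \<le> T" for i j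
    using that
  proof (induction rule: dec_induct)
    case (step t)
    then show ?case
      using triangle[of "Z i" "Z t" "Z (Suc t)"] V[of i] V[of t] V[of "Suc t"] steps[of t]
      by (simp add: algebra_simps)
  qed (simp add: self)
  have "w * (real j - real i - 1) \<le> D (Z i) (Z j)" if "i \<le> j" "j \<le> T" for i j
  proof -
    have "D (Z 0) (Z T) \<le> D (Z 0) (Z i) + D (Z i) (Z j) + D (Z j) (Z T)"
      using triangle[of "Z 0" "Z i" "Z T"] triangle[of "Z i" "Z j" "Z T"] V that by fastforce
    then show ?thesis
      using total up[of 0 i] up[of j T] that by (simp add: algebra_simps)
  qed
  with up show ?thesis by (simp add: efficient_def)
qed

text \<open>\<open>near_pole\<close> for the cell of order \<open>i\<close> around the branch point.
  The fork is required for every \<open>S\<close>, as the cell is chosen only in the proof.\<close>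

lemma diamond_fork:
  assumes D: "D = (\<lambda>x y. real (gdist (diamond (k + i)) x y))" and V: "V = verts (diamond (k + i))"
    and fork: "\<And>S. S \<subseteq> V \<Longrightarrow> Z c \<in> S \<Longrightarrow> fork D V S w C T c l Z Z'" and c: "Z c \<in> V"
    and i: "2 ^ i \<le> w * real l + E" "2 ^ i < w * (real c - 1)" "E \<ge> 0"
  shows "\<exists>z\<in>verts (diamond k). D (Z c) z \<le> E + (2 * C + 5) * w"
proof -
  have Zc: "Z c \<in> verts (diamond (k + i))" using c unfolding V .
  obtain S u v where S: "u \<in> verts (diamond k)" "v \<in> verts (diamond k)" "Z c \<in> S" "S \<subseteq> V"
    "\<And>x. x \<in> S \<Longrightarrow> gdist (diamond (k + i)) x u + gdist (diamond (k + i)) x v \<le> 2 ^ i"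
    "\<And>x y. x \<in> S \<Longrightarrow> y \<in> V - S \<Longrightarrow>
      gdist (diamond (k + i)) x u \<le> gdist (diamond (k + i)) x y \<or>
      gdist (diamond (k + i)) x v \<le> gdist (diamond (k + i)) x y"
    using diamond_cell[OF Zc] unfolding V by metis
  have uv: "u \<in> V" "v \<in> V" using S(1,2) verts_diamond_mono[of k "k + i"] unfolding V by auto
  have sum: "D x u + D x v \<le> 2 ^ i" if "x \<in> S" for x
    using S(5)[OF that] unfolding D
    by (metis of_nat_add of_nat_le_iff of_nat_numeral of_nat_power)
  have exit: "D x u \<le> D x y \<or> D x v \<le> D x y" if "x \<in> S" "y \<in> V - S" for x y
    using S(6)[OF that] unfolding D by simp
  have "D (Z c) u \<le> E + (2 * C + 5) * w \<or> D (Z c) v \<le> E + (2 * C + 5) * w"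
    using fork.near_pole[OF fork[OF S(4,3)] uv sum exit i] .
  then show ?thesis using S(1,2) by blast
qed

section \<open>An edge cannot be embedded efficiently\<close>

text \<open>Two refinements of \<open>uv\<close> supply the cycles, \<open>h\<close> more give
  chains of \<open>16 * L\<close> edges with images of length at most \<open>w\<close>, and
  \<open>j\<close> more lead to the embedded graph. By \<open>total\<close> one step is lost over a
  whole chain; the bound on \<open>L\<close> keeps the accumulated errors below the distance of the
  two branch points.\<close>

lemma no_efficient_edge:
  fixes F :: "vtx \<Rightarrow> vtx" and r C w :: real and h k j m :: nat
  defines "L \<equiv> (4::nat) ^ h"
  assumes C: "C \<ge> 1" and F_in: "\<And>x. x \<in> verts (laakso (k + 2 + h + j)) \<Longrightarrow> F x \<in> verts (diamond m)"
    and lower: "\<And>x y. x \<in> verts (laakso (k + 2 + h + j)) \<Longrightarrow> y \<in> verts (laakso (k + 2 + h + j)) \<Longrightarrow>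
      r * real (gdist (laakso (k + 2 + h + j)) x y) \<le> real (gdist (diamond m) (F x) (F y))"
    and r: "r > 0" and uv: "(u, v) \<in> laakso k"
    and steps: "\<And>x y. (x, y) \<in> laakso (k + 2 + h) \<Longrightarrow> real (gdist (diamond m) (F x) (F y)) \<le> w"
    and w_le: "w \<le> C * r * 4 ^ j" and w_ge: "w \<ge> 1"
    and total: "w * (16 * real L - 1) \<le> real (gdist (diamond m) (F u) (F v))"
    and L: "real L > 10 * (2 * C + 5) + 1"
  shows False
proof -
  define D where "D x y = real (gdist (diamond m) x y)" for x y
  define V where "V = verts (diamond m)"
  let ?N = "k + 2 + h + j"
  have triangle: "D x z \<le> D x y + D y z" if "x \<in> V" "y \<in> V" "z \<in> V" for x y z
    using gdist_triangle[OF connected_diamond, of x m y z] that by (simp add: D_def V_def)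
  have commute: "D x y = D y x" for x y
    by (simp add: D_def gdist_commute)
  have w_pos: "w > 0" using w_ge by simp
  have L_pos: "L > 0" and rL: "real L = 4 ^ h" by (simp_all add: L_def)

  (* In units of L, the chains Z1, Z2, Z3 run from u at 0 to v at 16. Z1 and Z2 take different sides
     of the small cycle with poles at 1 and 3, Z1 and Z3 of the large cycle with poles at 4 and 12. *)
  define R where "R = refine (\<lambda>_. 3)"
  define X0 where "X0 t = (if t = 0 then u else v)" for t :: nat
  define Y1 where "Y1 = R (R X0)"
  define Y2 where "Y2 = refine (\<lambda>b. if b = 0 then 4 else 3) (R X0)"
  define Y3 where "Y3 = R (refine (\<lambda>_. 4) X0)"
  define Z1 where "Z1 = (R ^^ h) Y1"
  define Z2 where "Z2 = (R ^^ h) Y2"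
  define Z3 where "Z3 = (R ^^ h) Y3"
  have X0: "(X0 t, X0 (Suc t)) \<in> laakso k" if "t < 1" for t
    using uv that by (simp add: X0_def)
  have X1: "(R X0 t, R X0 (Suc t)) \<in> laakso (Suc k)" "(refine (\<lambda>_. 4) X0 t, refine (\<lambda>_. 4) X0 (Suc t)) \<in> laakso (Suc k)"
    if "t < 4" for t
    using refine_edges[of 1 X0 "laakso k" "\<lambda>_. 3" t, OF X0] refine_edges[of 1 X0 "laakso k" "\<lambda>_. 4" t, OF X0] that
    by (auto simp: R_def)
  have Y: "(Y1 t, Y1 (Suc t)) \<in> laakso (k + 2)" "(Y2 t, Y2 (Suc t)) \<in> laakso (k + 2)"
    "(Y3 t, Y3 (Suc t)) \<in> laakso (k + 2)" if "t < 16" for t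
    using refine_edges[of 4 "R X0" "laakso (Suc k)" "\<lambda>_. 3" t, OF X1(1)]
      refine_edges[of 4 "R X0" "laakso (Suc k)" "\<lambda>b. if b = 0 then 4 else 3" t, OF X1(1)]
      refine_edges[of 4 "refine (\<lambda>_. 4) X0" "laakso (Suc k)" "\<lambda>_. 3" t, OF X1(2)] that
    by (auto simp: Y1_def Y2_def Y3_def R_def)
  have Z: "(Z1 t, Z1 (Suc t)) \<in> laakso (k + 2 + h)" "(Z2 t, Z2 (Suc t)) \<in> laakso (k + 2 + h)"
    "(Z3 t, Z3 (Suc t)) \<in> laakso (k + 2 + h)" if "t < 16 * L" for t
    using refine_funpow_edges[of 16 Y1 "k + 2" t h, OF Y(1)] refine_funpow_edges[of 16 Y2 "k + 2" t h, OF Y(2)]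
      refine_funpow_edges[of 16 Y3 "k + 2" t h, OF Y(3)] that
    unfolding Z1_def Z2_def Z3_def R_def L_def by blast+
  have Zmul: "Z1 (L * t) = Y1 t" "Z2 (L * t) = Y2 t" "Z3 (L * t) = Y3 t" for t
    unfolding Z1_def Z2_def Z3_def R_def L_def by (rule refine_funpow_mult)+
  have Y_vals: "Y1 0 = u" "Y2 0 = u" "Y3 0 = u" "Y1 16 = v" "Y2 16 = v" "Y3 16 = v"
    "Y1 1 = Y2 1" "Y1 12 = Y3 12"
    "Y1 2 = Mid (u, Mid (u, v) 2) 3" "Y2 2 = Mid (u, Mid (u, v) 2) 4"
    "Y1 8 = Mid (u, v) 3" "Y3 8 = Mid (u, v) 4"
    by (simp_all add: Y1_def Y2_def Y3_def R_def refine_def X0_def)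
  have "Y1 t = Y2 t" if "t \<ge> 3" for t
  proof -
    have "t div 4 \<noteq> 0 \<or> t mod 4 = 3" using that by presburger
    then show ?thesis by (auto simp: Y1_def Y2_def R_def refine_def)
  qed
  then have Z12: "Z1 t = Z2 t" if "t \<ge> 3 * L" for t
    using refine_funpow_agree_ge[of 3 Y1 Y2 h t] that unfolding Z1_def Z2_def R_def L_def by blast
  have "Y1 t = Y3 t" if "t \<le> 4" for t
  proof -
    have "t div 4 = 0 \<or> t div 4 = 1 \<and> t mod 4 = 0" using that by presburger
    then show ?thesis by (auto simp: Y1_def Y3_def R_def refine_def)
  qed
  then have Z13: "Z1 t = Z3 t" if "t \<le> 4 * L" for t
    using refine_funpow_agree_le[of 4 Y1 Y3 t h] that unfolding Z1_def Z3_def R_def L_def by blast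

  have chain: "(\<forall>t\<le>16 * L. F (Z t) \<in> V) \<and> efficient D w (16 * L) (F \<circ> Z)"
    if edges: "\<And>t. t < 16 * L \<Longrightarrow> (Z t, Z (Suc t)) \<in> laakso (k + 2 + h)"
      and ends: "Z 0 = u" "Z (L * 16) = v" for Z
  proof -
    have V: "F (Z t) \<in> V" if "t \<le> 16 * L" for t
      using chain_in_verts[of "16 * L" Z "laakso (k + 2 + h)" t, OF edges] that L_pos
        verts_laakso_mono[of "k + 2 + h" ?N] F_in unfolding V_def by auto
    have "efficient D w (16 * L) (F \<circ> Z)"
    proof (rule efficient_chain[where V = V])
      show "D x x = 0" for x by (simp add: D_def)
      show "(F \<circ> Z) t \<in> V" if "t \<le> 16 * L" for t using V that by simp
      show "D ((F \<circ> Z) t) ((F \<circ> Z) (Suc t)) \<le> w" if "t < 16 * L" for t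
        using steps edges[OF that] by (simp add: D_def)
      show "w * (real (16 * L) - 1) \<le> D ((F \<circ> Z) 0) ((F \<circ> Z) (16 * L))"
        using total ends by (simp add: D_def mult.commute)
    qed (rule triangle)
    with V show ?thesis by blast
  qed
  have Z0: "Z1 0 = u" "Z2 0 = u" "Z3 0 = u" "Z1 (L * 16) = v" "Z2 (L * 16) = v" "Z3 (L * 16) = v"
    using Zmul[of 0] Zmul[of 16] Y_vals by simp_all
  have chains: "\<And>t. t \<le> 16 * L \<Longrightarrow> F (Z1 t) \<in> V" "\<And>t. t \<le> 16 * L \<Longrightarrow> F (Z2 t) \<in> V"
    "\<And>t. t \<le> 16 * L \<Longrightarrow> F (Z3 t) \<in> V"
    "efficient D w (16 * L) (F \<circ> Z1)" "efficient D w (16 * L) (F \<circ> Z2)" "efficient D w (16 * L) (F \<circ> Z3)"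
    using chain[of Z1] chain[of Z2] chain[of Z3] Z Z0 by blast+

  \<comment> \<open>A distance \<open>4 ^ j * b\<close> in the embedded graph amounts to
    \<open>b\<close> steps of a chain; as \<open>w\<close> is at most \<open>C * r * 4 ^ j\<close>,
    the image keeps at least \<open>w * b / C\<close> of it.\<close>
  have separated: "w * b \<le> C * D (F x) (F y)"
    if "4 ^ j * b \<le> real (gdist (laakso ?N) x y)" "b \<ge> 0"
      "x \<in> verts (laakso (k + 2 + h))" "y \<in> verts (laakso (k + 2 + h))" for x y b
  proof -
    have "w * b \<le> C * r * 4 ^ j * b" using w_le that(2) by (rule mult_right_mono)
    also have "\<dots> = C * (r * (4 ^ j * b))" by simp
    also have "\<dots> \<le> C * (r * real (gdist (laakso ?N) x y))" using that(1) C r by (intro mult_left_mono) auto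
    also have "\<dots> \<le> C * D (F x) (F y)"
      using lower[of x y] that(3,4) verts_laakso_mono[of "k + 2 + h" ?N] C unfolding D_def
      by (intro mult_left_mono) auto
    finally show ?thesis .
  qed
  have Z_verts: "Z1 t \<in> verts (laakso (k + 2 + h))" "Z2 t \<in> verts (laakso (k + 2 + h))"
    "Z3 t \<in> verts (laakso (k + 2 + h))" if "t \<le> 16 * L" for t
    by (rule chain_in_verts[of "16 * L"]; use Z L_pos that in simp)+

  \<comment> \<open>The upper pole of the small cycle, at \<open>3 * L\<close>. The chains are
    reversed, so that the stem comes from \<open>v\<close> and has \<open>13 * L\<close>
    steps.\<close>
  have forkA: "fork D V S w C (16 * L) (13 * L) (2 * L) (\<lambda>t. (F \<circ> Z1) (16 * L - t)) (\<lambda>t. (F \<circ> Z2) (16 * L - t))"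
    if "S \<subseteq> V" "F (Z1 (3 * L)) \<in> S" for S
  proof
    show "w * min (real i - real (13 * L)) (real (13 * L) + real (2 * L) - real i)
        \<le> C * D ((F \<circ> Z1) (16 * L - i)) ((F \<circ> Z2) (16 * L - i'))"
      if i: "13 * L \<le> i" "i \<le> 13 * L + 2 * L" "13 * L \<le> i'" "i' \<le> 13 * L + 2 * L" for i i'
    proof -
      \<comment> \<open>A tent with zeros at the poles, rewritten in the unreversed position, where
        the midpoints of the sides are at \<open>L * 2\<close>.\<close>
      have eq: "min (real i - real (13 * L)) (real (13 * L) + real (2 * L) - real i) =
          4 ^ h - \<bar>real (16 * L - i) - real (L * 2)\<bar>"
        using i by (auto simp: min_def of_nat_diff L_def abs_if)
      have "real (13 * L) \<le> real i'" "real i' \<le> real (15 * L)" "real (16 * L - i') = real (16 * L) - real i'"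
        using i by (simp_all add: of_nat_diff)
      then have near: "\<bar>real (16 * L - i') - real (L * 2)\<bar> \<le> 4 ^ h"
        unfolding rL[symmetric] by linarith
      have e: "(u, Mid (u, v) 2) \<in> laakso (Suc k)"
        using laakso_stepI(1)[OF uv] by simp
      have "4 ^ j * (4 ^ h - \<bar>real (16 * L - i) - real (L * 2)\<bar>) \<le> real (gdist (laakso ?N) (Z1 (16 * L - i)) (Z2 (16 * L - i')))"
        using cycle_sides_separated[OF e, of "16 * L" Z1 h "L * 2" Z2 "16 * L - i" "16 * L - i'" j]
          Z Zmul Y_vals L_pos i near by simp
      from separated[OF this] show ?thesis
        using i Z_verts eq by (simp add: of_nat_diff)
    qed
    show "(F \<circ> Z2) (16 * L - i) = (F \<circ> Z1) (16 * L - i)" if "i \<le> 13 * L" for i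
      using Z12[of "16 * L - i"] that by simp
    show "(F \<circ> Z2) (16 * L - (13 * L + 2 * L)) = (F \<circ> Z1) (16 * L - (13 * L + 2 * L))"
      using Zmul[of 1] Y_vals by simp
    show "efficient D w (16 * L) (\<lambda>t. (F \<circ> Z1) (16 * L - t))" "efficient D w (16 * L) (\<lambda>t. (F \<circ> Z2) (16 * L - t))"
      using chains efficient_rev commute by blast+
  qed (use that chains triangle commute w_pos C in auto)
  \<comment> \<open>The lower pole of the large cycle, at \<open>4 * L\<close>, with the stem coming
    from \<open>u\<close>.\<close>
  have forkB: "fork D V S w C (16 * L) (4 * L) (8 * L) (F \<circ> Z1) (F \<circ> Z3)"
    if "S \<subseteq> V" "F (Z1 (4 * L)) \<in> S" for S
  proof
    show "w * min (real i - real (4 * L)) (real (4 * L) + real (8 * L) - real i)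
        \<le> C * D ((F \<circ> Z1) i) ((F \<circ> Z3) i')"
      if i: "4 * L \<le> i" "i \<le> 4 * L + 8 * L" "4 * L \<le> i'" "i' \<le> 4 * L + 8 * L" for i i'
    proof -
      have eq: "min (real i - real (4 * L)) (real (4 * L) + real (8 * L) - real i) =
          4 ^ Suc h - \<bar>real i - real (L * 8)\<bar>"
        using i by (auto simp: min_def L_def abs_if)
      have "real (4 * L) \<le> real i'" "real i' \<le> real (12 * L)"
        using i by simp_all
      then have near: "\<bar>real i' - real (L * 8)\<bar> \<le> 4 ^ Suc h"
        using rL by simp
      have "4 ^ j * (4 ^ Suc h - \<bar>real i - real (L * 8)\<bar>) \<le> real (gdist (laakso ?N) (Z1 i) (Z3 i'))"
        using cycle_sides_separated[OF uv, of "16 * L" Z1 "Suc h" "L * 8" Z3 i i' j]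
          Z Zmul Y_vals L_pos i near by simp
      from separated[OF this] show ?thesis
        using i Z_verts eq by simp
    qed
    show "(F \<circ> Z3) i = (F \<circ> Z1) i" if "i \<le> 4 * L" for i
      using Z13[of i] that by simp
    show "(F \<circ> Z3) (4 * L + 8 * L) = (F \<circ> Z1) (4 * L + 8 * L)"
      using Zmul[of 12] Y_vals by (simp add: mult.commute)
  qed (use that chains triangle commute w_pos C in auto)

  define a where "a = F (Z1 (3 * L))"
  define b where "b = F (Z1 (4 * L))"
  have ab: "a \<in> V" "b \<in> V" using chains(1) by (auto simp: a_def b_def)
  have ab_dist: "w * (real L - 1) \<le> D a b" "D a b \<le> w * real L"
    using chains(4)[unfolded efficient_def, rule_format, of "3 * L" "4 * L"] by (auto simp: a_def b_def)
  define E' where "E' = (2 * C + 5) * w"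
  have E'_pos: "E' > 0" using C w_pos by (simp add: E'_def)
  have wL: "w * real L > 10 * E' + w"
    using mult_strict_left_mono[OF L w_pos] by (simp add: E'_def algebra_simps)
  \<comment> \<open>Both branch points are close to vertices of \<open>diamond (m - i)\<close>,
    which are distinct and hence \<open>2 ^ i\<close> apart. This is used at two consecutive scales,
    first with \<open>E = 0\<close>, then with the slack \<open>E = 4 * E'\<close>.\<close>
  have coarse: "2 ^ i \<le> D a b + 2 * (E + E')"
    if i: "i \<le> m" "2 ^ i \<le> 2 * (w * real L) + E" "0 \<le> E" "E \<le> 4 * E'" for i E
  proof -
    have D: "D = (\<lambda>x y. real (gdist (diamond (m - i + i)) x y))" "V = verts (diamond (m - i + i))"
      using i(1) by (simp_all add: D_def V_def fun_eq_iff)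
    \<comment> \<open>The prongs of the first fork, of \<open>2 * L\<close> steps, dictate the bound
      \<open>2 * (w * real L) + E\<close>; the other three conditions have room to spare.\<close>
    have A: "2 ^ i \<le> w * real (2 * L) + E" "2 ^ i < w * (real (13 * L) - 1)"
      and B: "2 ^ i \<le> w * real (8 * L) + E" "2 ^ i < w * (real (4 * L) - 1)"
      using i wL E'_pos w_pos by (auto simp: algebra_simps)
    have "\<exists>x\<in>verts (diamond (m - i)). D ((\<lambda>t. (F \<circ> Z1) (16 * L - t)) (13 * L)) x \<le> E + (2 * C + 5) * w"
    proof (rule diamond_fork[OF D _ _ A i(3)])
      show "fork D V S w C (16 * L) (13 * L) (2 * L) (\<lambda>t. (F \<circ> Z1) (16 * L - t)) (\<lambda>t. (F \<circ> Z2) (16 * L - t))"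
        if "S \<subseteq> V" "(F \<circ> Z1) (16 * L - 13 * L) \<in> S" for S
        using that by (intro forkA) simp_all
    qed (use ab in \<open>simp add: a_def\<close>)
    then obtain x where x: "x \<in> verts (diamond (m - i))" "D a x \<le> E + E'"
      by (auto simp: a_def E'_def)
    have "\<exists>y\<in>verts (diamond (m - i)). D ((F \<circ> Z1) (4 * L)) y \<le> E + (2 * C + 5) * w"
    proof (rule diamond_fork[OF D _ _ B i(3)])
      show "fork D V S w C (16 * L) (4 * L) (8 * L) (F \<circ> Z1) (F \<circ> Z3)"
        if "S \<subseteq> V" "(F \<circ> Z1) (4 * L) \<in> S" for S
        using that by (intro forkB) simp_all
    qed (use ab in \<open>simp add: b_def\<close>)
    then obtain y where y: "y \<in> verts (diamond (m - i))" "D b y \<le> E + E'"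
      by (auto simp: b_def E'_def)
    have xy: "x \<in> V" "y \<in> V"
      using x y verts_diamond_mono[of "m - i" m] by (auto simp: V_def)
    \<comment> \<open>Otherwise \<open>a\<close> and \<open>b\<close> are within
      \<open>2 * (E + E')\<close>, at most \<open>10 * E'\<close>, of each other, less than
      \<open>w * (real L - 1)\<close>.\<close>
    have "x \<noteq> y"
    proof
      assume "x = y"
      then have "D a b \<le> 2 * (E + E')"
        using triangle[OF ab(1) xy(1) ab(2)] x y commute[of b] by simp
      then show False using ab_dist(1) wL i(4) w_pos by (simp add: algebra_simps)
    qed
    then have "2 ^ i \<le> gdist (diamond (m - i + i)) x y"
      using x y by (intro gdist_diamond_separated) auto
    then have "2 ^ i \<le> D x y"
      using i(1) unfolding D_def by (metis le_add_diff_inverse2 of_nat_le_iff of_nat_numeral of_nat_power)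
    moreover have "D x y \<le> D a x + D a b + D b y"
      using triangle[OF xy(1) ab(1) xy(2)] triangle[OF ab xy(2)] commute[of x] by simp
    ultimately show ?thesis using x y by simp
  qed

  have wL1: "w * real L \<ge> 1"
    using wL E'_pos w_ge by linarith
  \<comment> \<open>The first power of 2 above \<open>w * real L\<close>; by minimality it is at
    most \<open>2 * (w * real L)\<close>.\<close>
  define i where "i = (LEAST i. w * real L < 2 ^ i)"
  have "\<exists>i. w * real L < 2 ^ i" by (rule real_arch_pow) simp
  then have i: "w * real L < 2 ^ i" unfolding i_def by (rule LeastI_ex)
  then have "i \<noteq> 0" using wL1 by (intro notI) auto
  then have "\<not> w * real L < 2 ^ (i - 1)" unfolding i_def by (intro not_less_Least) auto
  then have i2: "2 ^ i \<le> 2 * (w * real L)"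
    using \<open>i \<noteq> 0\<close> by (cases i) auto
  \<comment> \<open>The images of \<open>u\<close> and \<open>v\<close> are about
    \<open>16 * L\<close> steps apart, while the diameter of \<open>diamond m\<close> is at most
    \<open>2 * 2 ^ m\<close>.\<close>
  have "Suc i \<le> m"
  proof -
    have "u \<in> verts (laakso ?N)" "v \<in> verts (laakso ?N)"
      using edge_verts[OF uv] verts_laakso_mono[of k ?N] by auto
    then have "gdist (diamond m) (F u) (F v) \<le> 2 * 2 ^ m"
      by (intro gdist_diamond_le F_in)
    then have "real (gdist (diamond m) (F u) (F v)) \<le> real (2 * 2 ^ m)"
      by (rule of_nat_mono)
    then have "real (gdist (diamond m) (F u) (F v)) \<le> 2 * 2 ^ m" by simp
    with total have "w * (16 * real L - 1) \<le> 2 * 2 ^ m" by linarith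
    then have "(2::real) ^ Suc i \<le> 2 ^ m"
      using i2 wL E'_pos w_pos unfolding right_diff_distrib power_Suc by linarith
    then show ?thesis by (rule power_le_imp_le_exp[rotated]) simp
  qed
  have "2 ^ i \<le> D a b + 2 * (0 + E')"
    by (rule coarse) (use \<open>Suc i \<le> m\<close> i2 E'_pos in auto)
  \<comment> \<open>As \<open>2 ^ i\<close> exceeds \<open>w * real L\<close> by at most
    \<open>2 * E'\<close>, the next scale is admissible with slack \<open>4 * E'\<close>. The result
    bounds \<open>2 ^ Suc i\<close> by \<open>w * real L + 10 * E'\<close>, which is less than
    \<open>2 * (w * real L)\<close>.\<close>
  then have "2 ^ Suc i \<le> D a b + 2 * (4 * E' + E')"
    by (intro coarse) (use \<open>Suc i \<le> m\<close> ab_dist E'_pos in auto)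
  then show False
    using i wL ab_dist(2) w_pos by simp
qed

section \<open>Coarse differentiation\<close>

lemma finite_laakso: "finite (laakso n)"
  by (induction n) (auto simp: laakso_step_def)

lemma laakso_nonempty: "laakso n \<noteq> {}"
  by (induction n) (auto simp: laakso_step_def)

text \<open>If \<open>M\<close> grew by more than the factor \<open>1 / q\<close> on each of the
  \<open>N\<close> blocks of length \<open>K\<close>, the total growth would contradict
  \<open>growth\<close>.\<close>

lemma slow_growth_block:
  fixes M :: "nat \<Rightarrow> real"
  assumes "0 < q" "q < 1" and growth: "M (N * K) * q ^ N < M 0"
  obtains i where "i < N" "q * M (Suc i * K) \<le> M (i * K)"
proof -
  have "\<exists>i<N. q * M (Suc i * K) \<le> M (i * K)"
  proof (rule ccontr)
    assume "\<not> ?thesis"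
    then have *: "M (i * K) < q * M (Suc i * K)" if "i < N" for i
      using that by auto
    have "M 0 \<le> q ^ i * M (i * K)" if "i \<le> N" for i
      using that
    proof (induction i)
      case (Suc i)
      then have "M 0 \<le> q ^ i * M (i * K)" by simp
      also have "\<dots> \<le> q ^ i * (q * M (Suc i * K))"
        using *[of i] Suc.prems assms(1) by (intro mult_left_mono) auto
      finally show ?case by (simp add: mult_ac)
    qed simp
    from this[of N] growth show False by (simp add: mult.commute)
  qed
  then show ?thesis using that by blast
qed

theorem theorem1p6:
  shows "\<not> (\<exists>(C::real) (m::nat \<Rightarrow> nat) (f::nat \<Rightarrow> vtx \<Rightarrow> vtx). C \<ge> 1 \<and>
      (\<forall>n. (\<forall>u\<in>verts (laakso n). f n u \<in> verts (diamond (m n))) \<and>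
           (\<exists>r::real. r > 0 \<and>
              (\<forall>u\<in>verts (laakso n). \<forall>v\<in>verts (laakso n).
                 r * real (gdist (laakso n) u v) \<le> real (gdist (diamond (m n)) (f n u) (f n v)) \<and>
                 real (gdist (diamond (m n)) (f n u) (f n v)) \<le> C * r * real (gdist (laakso n) u v)))))"
proof
  assume "\<exists>(C::real) (m::nat \<Rightarrow> nat) (f::nat \<Rightarrow> vtx \<Rightarrow> vtx). C \<ge> 1 \<and>
      (\<forall>n. (\<forall>u\<in>verts (laakso n). f n u \<in> verts (diamond (m n))) \<and>
           (\<exists>r::real. r > 0 \<and>
              (\<forall>u\<in>verts (laakso n). \<forall>v\<in>verts (laakso n).
                 r * real (gdist (laakso n) u v) \<le> real (gdist (diamond (m n)) (f n u) (f n v)) \<and>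
                 real (gdist (diamond (m n)) (f n u) (f n v)) \<le> C * r * real (gdist (laakso n) u v))))"
  then obtain C :: real and m f where C: "C \<ge> 1"
    and f: "\<And>n u. u \<in> verts (laakso n) \<Longrightarrow> f n u \<in> verts (diamond (m n))"
    and bilip: "\<And>n. \<exists>r::real. r > 0 \<and>
              (\<forall>u\<in>verts (laakso n). \<forall>v\<in>verts (laakso n).
                 r * real (gdist (laakso n) u v) \<le> real (gdist (diamond (m n)) (f n u) (f n v)) \<and>
                 real (gdist (diamond (m n)) (f n u) (f n v)) \<le> C * r * real (gdist (laakso n) u v))"
    by blast
  obtain h where h: "10 * (2 * C + 5) + 1 < (4::real) ^ h"
    using real_arch_pow[of 4] by auto
  define K where "K = Suc (Suc h)"
  \<comment> \<open>Then \<open>4 ^ K * q = 4 ^ K - 1\<close>: of the \<open>4 ^ K\<close> steps of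
    a chain across \<open>K\<close> levels one may be lost. \<open>K\<close> counts the two levels
    of the cycles and the \<open>h\<close> levels of resolution.\<close>
  define q :: real where "q = 1 - 1 / 4 ^ K"
  have "(1::real) < 4 ^ K" by (simp add: K_def one_less_power del: power_Suc)
  then have q: "0 < q" "q < 1" by (simp_all add: q_def)
  obtain N where N: "q ^ N < 1 / C"
    using real_arch_pow_inv[of "1 / C" q] q C by auto
  define n where "n = N * K"
  obtain r :: real where r: "r > 0"
    and lower: "\<And>u v. u \<in> verts (laakso n) \<Longrightarrow> v \<in> verts (laakso n) \<Longrightarrow>
      r * real (gdist (laakso n) u v) \<le> real (gdist (diamond (m n)) (f n u) (f n v))"
    and upper: "\<And>u v. u \<in> verts (laakso n) \<Longrightarrow> v \<in> verts (laakso n) \<Longrightarrow>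
      real (gdist (diamond (m n)) (f n u) (f n v)) \<le> C * r * real (gdist (laakso n) u v)"
    using bilip[of n] by blast
  define d where "d x y = gdist (diamond (m n)) (f n x) (f n y)" for x y
  define A where "A k = Max ((\<lambda>(x, y). d x y) ` laakso k)" for k
  have d_le_A: "d x y \<le> A k" if "(x, y) \<in> laakso k" for x y k
    unfolding A_def using that finite_laakso by (intro Max_ge) force+
  have A_attained: "\<exists>x y. (x, y) \<in> laakso k \<and> d x y = A k" for k
    using Max_in[of "(\<lambda>(x, y). d x y) ` laakso k"] finite_laakso[of k] laakso_nonempty[of k]
    unfolding A_def by fastforce
  \<comment> \<open>The gadget joins the ends of an edge by a path of four edges, here through side
    3.\<close>
  have A_step: "A k \<le> 4 * A (Suc k)" if k: "Suc k \<le> n" for k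
  proof -
    obtain x y where xy: "(x, y) \<in> laakso k" "d x y = A k" using A_attained by blast
    note I = laakso_stepI(1,2)[OF xy(1)] laakso_stepI(3,4)[OF xy(1), of 3, simplified]
    have "a \<in> verts (laakso n) \<and> b \<in> verts (laakso n)" if "(a, b) \<in> laakso_step (laakso k)" for a b
      using edge_verts[OF that] verts_laakso_mono[OF k] by auto
    note V = I[THEN this]
    have tri: "d a c \<le> d a b + d b c"
      if "a \<in> verts (laakso n)" "b \<in> verts (laakso n)" "c \<in> verts (laakso n)" for a b c
      unfolding d_def using that f by (intro gdist_triangle connected_diamond) auto
    have "d x y \<le> d x (Mid (x, y) 2) + d (Mid (x, y) 2) (Mid (x, y) 3) +
        d (Mid (x, y) 3) (Mid (x, y) 5) + d (Mid (x, y) 5) y"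
      using tri[of x "Mid (x, y) 2" y] tri[of "Mid (x, y) 2" "Mid (x, y) 3" y]
        tri[of "Mid (x, y) 3" "Mid (x, y) 5" y] V by linarith
    also have "\<dots> \<le> 4 * A (Suc k)"
      using I[THEN d_le_A[where k = "Suc k", simplified]] by linarith
    finally show ?thesis using xy by simp
  qed
  define M :: "nat \<Rightarrow> real" where "M k = 4 ^ k * real (A k)" for k
  have M_mono: "M i \<le> M k" if "i \<le> k" "k \<le> n" for i k
    using that
  proof (induction rule: dec_induct)
    case (step k)
    then have "M i \<le> M k" by simp
    also have "M k \<le> 4 ^ k * real (4 * A (Suc k))"
      unfolding M_def using A_step[of k] step by (intro mult_left_mono of_nat_mono) auto
    finally show ?case by (simp add: M_def)
  qed simp
  have M0: "r * 4 ^ n \<le> M 0"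
  proof -
    have "Base 0 \<in> verts (laakso n)" "Base 1 \<in> verts (laakso n)"
      using verts_laakso_mono[of 0 n] by (auto simp: verts_def)
    then have "r * real (gdist (laakso n) (Base 0) (Base 1)) \<le> real (d (Base 0) (Base 1))"
      unfolding d_def by (rule lower)
    moreover have "r * 4 ^ n \<le> r * real (gdist (laakso n) (Base 0) (Base 1))"
      using gdist_laakso_ends r by simp
    moreover have "M 0 = real (d (Base 0) (Base 1))" by (simp add: M_def A_def)
    ultimately show ?thesis by linarith
  qed
  have Mn: "M n \<le> 4 ^ n * (C * r)"
  proof -
    obtain x y where xy: "(x, y) \<in> laakso n" "d x y = A n" using A_attained by blast
    have "real (d x y) \<le> C * r * real (gdist (laakso n) x y)"
      unfolding d_def using edge_verts[OF xy(1)] by (intro upper) auto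
    also have "\<dots> \<le> C * r * 1"
      using gdist_edge[OF xy(1)] C r by (intro mult_left_mono) auto
    finally show ?thesis using xy by (simp add: M_def)
  qed
  \<comment> \<open>From level 0 to level \<open>n\<close> the growth of \<open>M\<close> is at most
    by the factor \<open>C\<close>, and \<open>C * q ^ N < 1\<close>.\<close>
  have "M (N * K) * q ^ N \<le> (4 ^ n * (C * r)) * q ^ N"
    using Mn q unfolding n_def by (intro mult_right_mono) auto
  also have "\<dots> < (4 ^ n * (C * r)) * (1 / C)"
    using N C r by (intro mult_strict_left_mono) auto
  also have "\<dots> = r * 4 ^ n" using C by simp
  also have "\<dots> \<le> M 0" by (rule M0)
  finally obtain i where i: "i < N" "q * M (Suc i * K) \<le> M (i * K)"
    using slow_growth_block[OF q] by blast
  define k where "k = i * K"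
  have "Suc i * K \<le> N * K" using i(1) by (intro mult_le_mono) auto
  then have kn: "k + K \<le> n" by (simp add: k_def n_def add.commute)
  define j where "j = n - (k + K)"
  have n: "n = k + 2 + h + j" and kK: "k + K = k + 2 + h" using kn by (auto simp: j_def K_def)
  define w where "w = real (A (k + K))"
  \<comment> \<open>The edge with the longest image at the coarse end of the block is compared with
    the longest image \<open>w\<close> at its fine end.\<close>
  obtain u v where uv: "(u, v) \<in> laakso k" "d u v = A k" using A_attained by blast
  have "4 ^ k * (4 ^ K * (w * q)) \<le> 4 ^ k * real (A k)"
    using i(2) by (simp add: M_def k_def w_def power_add mult_ac add.commute)
  then have qw: "4 ^ K * (w * q) \<le> real (A k)" by simp
  show False
  proof (rule no_efficient_edge[where F = "f n" and h = h and k = k and j = j and m = "m n"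
        and r = r and C = C and w = w and u = u and v = v])
    show "f n x \<in> verts (diamond (m n))" if "x \<in> verts (laakso (k + 2 + h + j))" for x
      using f that n by simp
    show "r * real (gdist (laakso (k + 2 + h + j)) x y) \<le> real (gdist (diamond (m n)) (f n x) (f n y))"
      if "x \<in> verts (laakso (k + 2 + h + j))" "y \<in> verts (laakso (k + 2 + h + j))" for x y
      using lower that n by simp
    show "real (gdist (diamond (m n)) (f n x) (f n y)) \<le> w" if "(x, y) \<in> laakso (k + 2 + h)" for x y
      using d_le_A that unfolding w_def d_def kK by simp
    \<comment> \<open>Image distances are natural numbers, so a positive maximum is at least
      1.\<close>
    have "0 < M (k + K)" using M0 M_mono[of 0 "k + K"] kn r
      by (smt (verit) le0 zero_less_mult_iff zero_less_power)
    then have "0 < A (k + K)" by (simp add: M_def zero_less_mult_iff)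
    then show "1 \<le> w" by (simp add: w_def Suc_le_eq)
    have "4 ^ (k + K) * w \<le> 4 ^ n * (C * r)"
      using order_trans[OF M_mono[of "k + K" n] Mn] kn by (simp add: M_def[of "k + K"] w_def)
    also have "\<dots> = 4 ^ (k + K) * (C * r * 4 ^ j)"
      using kn by (simp add: j_def flip: power_add)
    finally show "w \<le> C * r * 4 ^ j" by simp
    have "w * (16 * real (4 ^ h) - 1) = 4 ^ K * (w * q)"
      by (simp add: q_def K_def algebra_simps)
    then show "w * (16 * real (4 ^ h) - 1) \<le> real (gdist (diamond (m n)) (f n u) (f n v))"
      using qw uv(2) unfolding d_def by linarith
    show "10 * (2 * C + 5) + 1 < real (4 ^ h)" using h by simp
  qed (use C r uv in auto)
qed

end
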